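(* Let $\mathcal{E}$ be an instance of the Evolomino puzzle on a board $\mathcal{C}$ with arrow set $\mathcal{A}$, and let $S(\mathcal{E})$ be the associated system of linear constraints (both defined in the context), in which the variables $x_i$, $y^{ak}_i$, $b_{ak}$, $t^{ak}_{pq}$ are binary and the variables $N_{ak}$, $f^{ak}_{ij}$, $F^{ak}_i$ are integral. Then an assignment $\{x_i\}_{i\in\mathcal{C}}$, $x_i\in\{0,1\}$, of the cell variables corresponds to a valid solution of $\mathcal{E}$ (that is, placing squares in exactly the cells $i$ with $x_i=1$ is a valid solution of $\mathcal{E}$) if and only if there exists an integral assignment to the auxiliary variables $y^{ak}_i$ (binary), $b_{ak}$ (binary), $t^{ak}_{pq}$ (binary), $N_{ak}$, $f^{ak}_{ij}$, $F^{ak}_i$ (integers) that together with $\{x_i\}_{i\in\mathcal{C}}$ satisfies $S(\mathcal{E})$.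
   Context: **Puzzle.** An Evolomino instance $\mathcal{E}$ consists of a rectangular $m\times n$ board whose cell set is $\mathcal{C}=\{1,\dots,mn\}$ (cells numbered row by row from the top-left corner; $\operatorname{row}(i)\in\{1,\dots,m\}$ and $\operatorname{col}(i)\in\{1,\dots,n\}$ are the row and column of cell $i$, so $i=(\operatorname{row}(i)-1)n+\operatorname{col}(i)$). Each cell is white or shaded. Some white cells contain pre-drawn squares. There is a finite set $\mathcal{A}$ of pre-drawn arrows; each arrow $a$ is a directed path of distinct white cells, consecutive ones orthogonally adjacent (sharing a side), and different arrows use disjoint sets of cells. Pre-drawn squares may lie on or off arrows. **Valid solution.** A set of cells $Q\subseteq\mathcal{C}$ (the cells containing squares) is a valid solution of $\mathcal{E}$ if: $Q$ contains all cells with pre-drawn squares and no shaded cell; calling *blocks* the connected components of $Q$ under orthogonal adjacency (a single square may be a block), each block contains exactly one cell lying on an arrow (counting all arrows); each arrow passes through at least two blocks; and, for each arrow, if its blocks are listed in the order in which they are met from the start to the end of the arrow, each block from the second on is obtained from the previous block by translation (no rotation or reflection) and the addition of exactly one square. **Notation.** - $\mathcal{P}_a\subset\mathcal{C}$: the set of cells of arrow $a$. $\operatorname{next}_a(i)$: the cell following $i\in\mathcal{P}_a$ along $a$ (defined unless $i$ is the last cell). $\mathcal{P}^{\prec i}_a$: the set of cells of $\mathcal{P}_a$ strictly preceding $i$ along $a$. - $K_a=\lceil|\mathcal{P}_a|/2\rceil$, the maximum possible number of blocks along $a$. - $\mathcal{C}_a$: the set of cells that may belong to a block of arrow $a$.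 Starting from a cell of arrow $a$, it consists of all cells reachable by orthogonal paths not passing through (nor ending in) shaded cells, cells of other arrows, or cells belonging to blocks of other arrows. The last category means cells not on $a$ that are orthogonally adjacent to a pre-drawn square lying on another arrow. In particular $\mathcal{P}_a\subseteq\mathcal{C}_a$. - $\mathcal{N}(i)$, for a fixed arrow $a$ and $i\in\mathcal{C}_a$: the set of cells of $\mathcal{C}_a$ orthogonally adjacent to $i$. - $M$: a fixed sufficiently large constant exceeding the size of any polyomino block, for example $M=|\mathcal{C}|$. - $\mathcal{T}$: the set of integer pairs $(p,q)$ with $|p|\le m-1$, $|q|\le n-1$, $|p|+|q|>1$. $\operatorname{shift}(i,p,q)=i+pn+q$. - $\mathcal{T}^a_i$, for $i\in\mathcal{C}_a$: the set of $(p,q)\in\mathcal{T}$ with $1\le\operatorname{row}(i)+p\le m$, $1\le\operatorname{col}(i)+q\le n$ and $\operatorname{shift}(i,p,q)\in\mathcal{C}_a$. - $\mathcal{T}_a=\bigcup_{i\in\mathcal{P}_a}\mathcal{T}^a_i$. **Variables.** $x_i\in\{0,1\}$ ($i\in\mathcal{C}$). For $a\in\mathcal{A}$ and $1\le k\le K_a$: $y^{ak}_i\in\{0,1\}$ ($i\in\mathcal{C}_a$), $b_{ak}\in\{0,1\}$, $N_{ak}\in\mathbb{Z}$, $F^{ak}_i\in\mathbb{Z}$ ($i\in\mathcal{P}_a$), $f^{ak}_{ij}\in\mathbb{Z}$ for each ordered pair of adjacent cells $i,j\in\mathcal{C}_a$. For $2\le k\le K_a$: $t^{ak}_{pq}\in\{0,1\}$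 ($(p,q)\in\mathcal{T}_a$). **The system $S(\mathcal{E})$.** Clue and activation settings: $x_i=1$ for each cell $i$ with a pre-drawn square, $x_i=0$ for each shaded cell $i$, and $b_{a1}=b_{a2}=1$ for every $a\in\mathcal{A}$ (if $K_a<2$ for some $a$, this requirement is regarded as unsatisfiable). Unless otherwise indicated, each constraint below is imposed for all $a\in\mathcal{A}$ and all $k=1,\dots,K_a$. Basic constraints: 1. $\sum_{a\in\mathcal{A}:\,i\in\mathcal{C}_a}\sum_{k=1}^{K_a}y^{ak}_i=x_i$ for all $i\in\mathcal{C}$. 2. $x_i+x_{\operatorname{next}_a(i)}\le 1$ for all $a\in\mathcal{A}$ and all $i\in\mathcal{P}_a$ for which $\operatorname{next}_a(i)$ is defined. 3. $\sum_{i\in\mathcal{C}_a}y^{ak}_i\le M\,b_{ak}$. 4. $\sum_{i\in\mathcal{P}_a}y^{ak}_i=b_{ak}$. 5. $b_{ak}\le b_{a,k-1}$ for $k=2,\dots,K_a$. 6. $\sum_{j\in\mathcal{P}^{\prec i}_a}y^{ak}_j\le 1-y^{a,k-1}_i$ for all $i\in\mathcal{P}_a$, $k=2,\dots,K_a$. 7. $y^{ak}_i+y^{a'k'}_{i+1}\le 1$ for all $a,a'\in\mathcal{A}$, $1\le k\le K_a$, $1\le k'\le K_{a'}$ with $a\ne a'$ or $k\ne k'$, and all $i\in\mathcal{C}_a$ with $\operatorname{col}(i)<n$ and $i+1\in\mathcal{C}_{a'}$. 8. $y^{ak}_i+y^{a'k'}_{i+n}\le 1$ for all $a,a'\in\mathcal{A}$,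 $1\le k\le K_a$, $1\le k'\le K_{a'}$ with $a\ne a'$ or $k\ne k'$, and all $i\in\mathcal{C}_a$ with $\operatorname{row}(i)<m$ and $i+n\in\mathcal{C}_{a'}$. 9. $N_{ak}=\sum_{i\in\mathcal{C}_a}y^{ak}_i$. 10. $N_{ak}\ge N_{a,k-1}+1-M(1-b_{ak})$ for $k=2,\dots,K_a$. 11. $N_{ak}\le N_{a,k-1}+1+M(1-b_{ak})$ for $k=2,\dots,K_a$. Connectivity constraints: 12. $\sum_{i\in\mathcal{P}_a}F^{ak}_i=N_{ak}$. 13. $0\le F^{ak}_i\le M\,y^{ak}_i$ for all $i\in\mathcal{P}_a$. 14. $f^{ak}_{ij}\le M\,y^{ak}_i$ for all $i\in\mathcal{C}_a$, $j\in\mathcal{N}(i)$. 15. $f^{ak}_{ij}\le M\,y^{ak}_j$ for all $i\in\mathcal{C}_a$, $j\in\mathcal{N}(i)$. 16. $f^{ak}_{ij}\ge 0$ for all $i\in\mathcal{C}_a$, $j\in\mathcal{N}(i)$. 17. $\sum_{j\in\mathcal{N}(i)}f^{ak}_{ji}-\sum_{j\in\mathcal{N}(i)}f^{ak}_{ij}=y^{ak}_i$ for all $i\in\mathcal{C}_a\setminus\mathcal{P}_a$. 18. $\sum_{j\in\mathcal{N}(i)\setminus\mathcal{P}_a}f^{ak}_{ji}-\sum_{j\in\mathcal{N}(i)\setminus\mathcal{P}_a}f^{ak}_{ij}=y^{ak}_i-F^{ak}_i$ for all $i\in\mathcal{P}_a$. Evolution constraints (for $k=2,\dots,K_a$): 19.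 $\sum_{(p,q)\in\mathcal{T}_a}t^{ak}_{pq}=b_{ak}$. 20. $\sum_{(p,q)\in\mathcal{T}^a_i\cap\mathcal{T}_a}t^{ak}_{pq}\ge y^{a,k-1}_i+b_{ak}-1$ for all $i\in\mathcal{C}_a$. 21. $y^{ak}_{\operatorname{shift}(i,p,q)}\ge y^{a,k-1}_i-(1-t^{ak}_{pq})$ for all $i\in\mathcal{C}_a$, $(p,q)\in\mathcal{T}^a_i\cap\mathcal{T}_a$. *)

theory Defs
  imports Main
begin

(* Cells are numbered row by row, starting from 1. Arrows are the lists of their cells, from
   start to end. *)
record evolomino =
  nrows :: nat
  ncols :: nat
  shaded :: "nat set"
  squares :: "nat set"
  arrows :: "nat list set"

definition board :: "evolomino \<Rightarrow> nat set" where
  "board E = {1..nrows E * ncols E}"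

definition row_of :: "evolomino \<Rightarrow> nat \<Rightarrow> nat" where
  "row_of E i = (i - 1) div ncols E + 1"

definition col_of :: "evolomino \<Rightarrow> nat \<Rightarrow> nat" where
  "col_of E i = (i - 1) mod ncols E + 1"

definition adjacent :: "evolomino \<Rightarrow> nat \<Rightarrow> nat \<Rightarrow> bool" where
  "adjacent E i j \<longleftrightarrow> i \<in> board E \<and> j \<in> board E \<and>
     \<bar>int (row_of E i) - int (row_of E j)\<bar> + \<bar>int (col_of E i) - int (col_of E j)\<bar> = 1"

definition evolomino_instance :: "evolomino \<Rightarrow> bool" where
  "evolomino_instance E \<longleftrightarrow>
     1 \<le> nrows E \<and> 1 \<le> ncols E \<and>
     shaded E \<subseteq> board E \<and>
     squares E \<subseteq> board E - shaded E \<and>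
     finite (arrows E) \<and>
     (\<forall>a\<in>arrows E. a \<noteq> [] \<and> distinct a \<and> set a \<subseteq> board E - shaded E \<and>
        successively (adjacent E) a) \<and>
     (\<forall>a\<in>arrows E. \<forall>a'\<in>arrows E. a \<noteq> a' \<longrightarrow> set a \<inter> set a' = {})"


section \<open>Valid solutions\<close>

definition block_of :: "evolomino \<Rightarrow> nat set \<Rightarrow> nat \<Rightarrow> nat set" where
  "block_of E Q i = {j. (\<lambda>u v. u \<in> Q \<and> v \<in> Q \<and> adjacent E u v)\<^sup>*\<^sup>* i j}"

definition blocks :: "evolomino \<Rightarrow> nat set \<Rightarrow> nat set set" where
  "blocks E Q = block_of E Q ` Q"

definition arrow_cells :: "evolomino \<Rightarrow> nat set" where
  "arrow_cells E = (\<Union>a\<in>arrows E. set a)"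

(* The blocks of Q met along the arrow a, in order. No block is listed twice if every block has
   exactly one cell on an arrow, which valid_solution requires. *)
definition blocks_along :: "evolomino \<Rightarrow> nat set \<Rightarrow> nat list \<Rightarrow> nat set list" where
  "blocks_along E Q a = map (block_of E Q) (filter (\<lambda>i. i \<in> Q) a)"

definition coords :: "evolomino \<Rightarrow> nat set \<Rightarrow> (int \<times> int) set" where
  "coords E B = (\<lambda>i. (int (row_of E i), int (col_of E i))) ` B"

definition evolves :: "evolomino \<Rightarrow> nat set \<Rightarrow> nat set \<Rightarrow> bool" where
  "evolves E B B' \<longleftrightarrow>
     (\<exists>p q c. c \<notin> (\<lambda>(r, s). (r + p, s + q)) ` coords E B \<and>
        coords E B' = insert c ((\<lambda>(r, s). (r + p, s + q)) ` coords E B))"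

definition valid_solution :: "evolomino \<Rightarrow> nat set \<Rightarrow> bool" where
  "valid_solution E Q \<longleftrightarrow>
     Q \<subseteq> board E \<and> squares E \<subseteq> Q \<and> Q \<inter> shaded E = {} \<and>
     (\<forall>B\<in>blocks E Q. card (B \<inter> arrow_cells E) = 1) \<and>
     (\<forall>a\<in>arrows E. 2 \<le> card {B \<in> blocks E Q. B \<inter> set a \<noteq> {}}) \<and>
     (\<forall>a\<in>arrows E. successively (evolves E) (blocks_along E Q a))"


section \<open>Index sets of the linear system\<close>

(* The ceiling of half the number of cells of the arrow. *)
definition max_blocks :: "nat list \<Rightarrow> nat" where
  "max_blocks a = (length a + 1) div 2"

definition preceding :: "nat list \<Rightarrow> nat \<Rightarrow> nat set" where
  "preceding a i = {a ! l |l l'. l < l' \<and> l' < length a \<and> a ! l' = i}"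

definition excluded :: "evolomino \<Rightarrow> nat list \<Rightarrow> nat set" where
  "excluded E a =
     shaded E
     \<union> (\<Union>a'\<in>arrows E - {a}. set a')
     \<union> {j. j \<notin> set a \<and> (\<exists>a'\<in>arrows E - {a}. \<exists>s\<in>squares E \<inter> set a'. adjacent E s j)}"

definition reach :: "evolomino \<Rightarrow> nat list \<Rightarrow> nat set" where
  "reach E a = {j. \<exists>i\<in>set a. (\<lambda>u v. adjacent E u v \<and> v \<notin> excluded E a)\<^sup>*\<^sup>* i j}"

definition nbrs :: "evolomino \<Rightarrow> nat list \<Rightarrow> nat \<Rightarrow> nat set" where
  "nbrs E a i = {j \<in> reach E a. adjacent E i j}"

definition shifts :: "evolomino \<Rightarrow> (int \<times> int) set" where
  "shifts E = {(p, q). \<bar>p\<bar> \<le> int (nrows E) - 1 \<and> \<bar>q\<bar> \<le> int (ncols E) - 1 \<and> \<bar>p\<bar> + \<bar>q\<bar> > 1}"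

definition shift :: "evolomino \<Rightarrow> nat \<Rightarrow> int \<Rightarrow> int \<Rightarrow> nat" where
  "shift E i p q = nat (int i + p * int (ncols E) + q)"

definition shifts_at :: "evolomino \<Rightarrow> nat list \<Rightarrow> nat \<Rightarrow> (int \<times> int) set" where
  "shifts_at E a i = {(p, q) \<in> shifts E.
     1 \<le> int (row_of E i) + p \<and> int (row_of E i) + p \<le> int (nrows E) \<and>
     1 \<le> int (col_of E i) + q \<and> int (col_of E i) + q \<le> int (ncols E) \<and>
     shift E i p q \<in> reach E a}"

definition shifts_of :: "evolomino \<Rightarrow> nat list \<Rightarrow> (int \<times> int) set" where
  "shifts_of E a = (\<Union>i\<in>set a. shifts_at E a i)"


section \<open>The linear system\<close>

(* All variables are integer-valued. Their values outside the index sets above are irrelevant. *)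
type_synonym cell_var = "nat \<Rightarrow> int"
type_synonym y_var = "nat list \<Rightarrow> nat \<Rightarrow> nat \<Rightarrow> int"
type_synonym block_var = "nat list \<Rightarrow> nat \<Rightarrow> int"
type_synonym t_var = "nat list \<Rightarrow> nat \<Rightarrow> int \<times> int \<Rightarrow> int"
type_synonym flow_var = "nat list \<Rightarrow> nat \<Rightarrow> nat \<Rightarrow> nat \<Rightarrow> int"

definition binary_vars :: "evolomino \<Rightarrow> y_var \<Rightarrow> block_var \<Rightarrow> t_var \<Rightarrow> bool" where
  "binary_vars E y b t \<longleftrightarrow> (\<forall>a\<in>arrows E.
     (\<forall>k\<in>{1..max_blocks a}. b a k \<in> {0, 1} \<and> (\<forall>i\<in>reach E a. y a k i \<in> {0, 1})) \<and>
     (\<forall>k\<in>{2..max_blocks a}. \<forall>pq\<in>shifts_of E a. t a k pq \<in> {0, 1}))"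

definition clue_constraints :: "evolomino \<Rightarrow> cell_var \<Rightarrow> block_var \<Rightarrow> bool" where
  "clue_constraints E x b \<longleftrightarrow>
     (\<forall>i\<in>squares E. x i = 1) \<and>
     (\<forall>i\<in>shaded E. x i = 0) \<and>
     (\<forall>a\<in>arrows E. 2 \<le> max_blocks a \<and> b a 1 = 1 \<and> b a 2 = 1)"

definition basic_constraints ::
  "evolomino \<Rightarrow> int \<Rightarrow> cell_var \<Rightarrow> y_var \<Rightarrow> block_var \<Rightarrow> block_var \<Rightarrow> bool" where
  "basic_constraints E M x y b N \<longleftrightarrow>
     (\<forall>i\<in>board E. (\<Sum>a\<in>{a \<in> arrows E. i \<in> reach E a}. \<Sum>k=1..max_blocks a. y a k i) = x i) \<and>
     (\<forall>a\<in>arrows E. \<forall>l. Suc l < length a \<longrightarrow> x (a ! l) + x (a ! Suc l) \<le> 1) \<and>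
     (\<forall>a\<in>arrows E. \<forall>k\<in>{1..max_blocks a}.
        (\<Sum>i\<in>reach E a. y a k i) \<le> M * b a k \<and>
        (\<Sum>i\<in>set a. y a k i) = b a k) \<and>
     (\<forall>a\<in>arrows E. \<forall>k\<in>{2..max_blocks a}.
        b a k \<le> b a (k - 1) \<and>
        (\<forall>i\<in>set a. (\<Sum>j\<in>preceding a i. y a k j) \<le> 1 - y a (k - 1) i)) \<and>
     (\<forall>a\<in>arrows E. \<forall>a'\<in>arrows E. \<forall>k\<in>{1..max_blocks a}. \<forall>k'\<in>{1..max_blocks a'}.
        a \<noteq> a' \<or> k \<noteq> k' \<longrightarrow>
          (\<forall>i\<in>reach E a. col_of E i < ncols E \<and> i + 1 \<in> reach E a' \<longrightarrow>
             y a k i + y a' k' (i + 1) \<le> 1) \<and>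
          (\<forall>i\<in>reach E a. row_of E i < nrows E \<and> i + ncols E \<in> reach E a' \<longrightarrow>
             y a k i + y a' k' (i + ncols E) \<le> 1)) \<and>
     (\<forall>a\<in>arrows E. \<forall>k\<in>{1..max_blocks a}. N a k = (\<Sum>i\<in>reach E a. y a k i)) \<and>
     (\<forall>a\<in>arrows E. \<forall>k\<in>{2..max_blocks a}.
        N a k \<ge> N a (k - 1) + 1 - M * (1 - b a k) \<and>
        N a k \<le> N a (k - 1) + 1 + M * (1 - b a k))"

definition connectivity_constraints ::
  "evolomino \<Rightarrow> int \<Rightarrow> y_var \<Rightarrow> block_var \<Rightarrow> flow_var \<Rightarrow> y_var \<Rightarrow> bool" where
  "connectivity_constraints E M y N f F \<longleftrightarrow> (\<forall>a\<in>arrows E. \<forall>k\<in>{1..max_blocks a}.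
     (\<Sum>i\<in>set a. F a k i) = N a k \<and>
     (\<forall>i\<in>set a. 0 \<le> F a k i \<and> F a k i \<le> M * y a k i) \<and>
     (\<forall>i\<in>reach E a. \<forall>j\<in>nbrs E a i.
        f a k i j \<le> M * y a k i \<and> f a k i j \<le> M * y a k j \<and> f a k i j \<ge> 0) \<and>
     (\<forall>i\<in>reach E a - set a.
        (\<Sum>j\<in>nbrs E a i. f a k j i) - (\<Sum>j\<in>nbrs E a i. f a k i j) = y a k i) \<and>
     (\<forall>i\<in>set a.
        (\<Sum>j\<in>nbrs E a i - set a. f a k j i) - (\<Sum>j\<in>nbrs E a i - set a. f a k i j)
          = y a k i - F a k i))"

definition evolution_constraints ::
  "evolomino \<Rightarrow> y_var \<Rightarrow> block_var \<Rightarrow> t_var \<Rightarrow> bool" where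
  "evolution_constraints E y b t \<longleftrightarrow> (\<forall>a\<in>arrows E. \<forall>k\<in>{2..max_blocks a}.
     (\<Sum>pq\<in>shifts_of E a. t a k pq) = b a k \<and>
     (\<forall>i\<in>reach E a.
        (\<Sum>pq\<in>shifts_at E a i \<inter> shifts_of E a. t a k pq) \<ge> y a (k - 1) i + b a k - 1) \<and>
     (\<forall>i\<in>reach E a. \<forall>(p, q)\<in>shifts_at E a i \<inter> shifts_of E a.
        y a k (shift E i p q) \<ge> y a (k - 1) i - (1 - t a k (p, q))))"

definition satisfies_system ::
  "evolomino \<Rightarrow> int \<Rightarrow> cell_var \<Rightarrow> y_var \<Rightarrow> block_var \<Rightarrow> t_var \<Rightarrow> block_var \<Rightarrow> flow_var \<Rightarrow> y_var \<Rightarrow> bool"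
  where
  "satisfies_system E M x y b t N f F \<longleftrightarrow>
     clue_constraints E x b \<and>
     basic_constraints E M x y b N \<and>
     connectivity_constraints E M y N f F \<and>
     evolution_constraints E y b t"

(* Polyomino blocks are the blocks of valid solutions. *)
definition exceeds_blocks :: "evolomino \<Rightarrow> int \<Rightarrow> bool" where
  "exceeds_blocks E M \<longleftrightarrow>
     (\<forall>Q B. valid_solution E Q \<longrightarrow> B \<in> blocks E Q \<longrightarrow> int (card B) < M)"

(* In particular M may be the number of cells: a block is never the whole board, because the
   arrow it meets passes through another block as well. *)
lemma exceeds_blocks_board:
  assumes "int (card (board E)) \<le> M"
  shows "exceeds_blocks E M"
  unfolding exceeds_blocks_def
proof (intro allI impI)
  fix Q B
  assume v: "valid_solution E Q" and B: "B \<in> blocks E Q"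
  have Q: "Q \<subseteq> board E" and one: "card (B \<inter> arrow_cells E) = 1"
    and two: "\<And>a. a \<in> arrows E \<Longrightarrow> 2 \<le> card {B \<in> blocks E Q. B \<inter> set a \<noteq> {}}"
    using v B unfolding valid_solution_def by auto
  have in_Q: "C \<subseteq> Q" if "C \<in> blocks E Q" for C
  proof
    fix j assume "j \<in> C"
    with that obtain i where "i \<in> Q"
      and "(\<lambda>u v. u \<in> Q \<and> v \<in> Q \<and> adjacent E u v)\<^sup>*\<^sup>* i j"
      unfolding blocks_def block_of_def by auto
    from this(2,1) show "j \<in> Q" by (induction rule: rtranclp_induct) auto
  qed
  have "symp (\<lambda>u v. u \<in> Q \<and> v \<in> Q \<and> adjacent E u v)"
    by (auto simp: symp_def adjacent_def abs_minus_commute)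
  then have sym: "symp (\<lambda>u v. u \<in> Q \<and> v \<in> Q \<and> adjacent E u v)\<^sup>*\<^sup>*"
    by (rule symp_rtranclp)
  have eq: "block_of E Q i = block_of E Q j" if "j \<in> block_of E Q i" for i j
    using that sympD[OF sym] unfolding block_of_def by (auto intro: rtranclp_trans)
  have "B \<noteq> board E"
  proof
    assume whole: "B = board E"
    have "C = B" if C: "C \<in> blocks E Q" for C
    proof -
      obtain i j where "i \<in> Q" "C = block_of E Q i" "B = block_of E Q j"
        using B C unfolding blocks_def by auto
      then show ?thesis using eq[of i j] whole Q by auto
    qed
    then have sub: "{B \<in> blocks E Q. B \<inter> set a \<noteq> {}} \<subseteq> {B}" for a
      by auto
    obtain i where "i \<in> B \<inter> arrow_cells E"
      using one by (metis card.empty equals0I zero_neq_one)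
    then obtain a where "a \<in> arrows E"
      unfolding arrow_cells_def by auto
    then have "2 \<le> card {B \<in> blocks E Q. B \<inter> set a \<noteq> {}}" by (rule two)
    moreover have "card {B \<in> blocks E Q. B \<inter> set a \<noteq> {}} \<le> card {B}"
      by (rule card_mono[OF _ sub]) simp
    ultimately show False by simp
  qed
  then have "B \<subset> board E" using in_Q[OF B] Q by auto
  then have "card B < card (board E)"
    by (rule psubset_card_mono[rotated]) (simp add: board_def)
  with assms show "int (card B) < M" by simp
qed

end

theory Submission
  imports Defs
begin

text \<open>
  A valid solution and a solution of the system are two ways to give the same object: a family of
  cell sets indexed by the arrows \<open>a\<close> and the numbers \<open>k\<close> up to the number of blocks along \<open>a\<close>,
  whose member at \<open>(a, k)\<close> is the \<open>k\<close>th block that the arrow meets.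

  Given a solution of the system, let \<open>cells (a, k)\<close> be the set of cells \<open>i\<close> with \<open>y a k i = 1\<close>.
  The first constraint makes these sets a partition of the squares, and the separation constraints
  keep them from touching each other, so each is a union of connected components. The set of an
  active index contains exactly one cell of its arrow, and it contains no cell of another arrow
  because it lies in the region of \<open>a\<close>. What is left is that it is connected
  (\<open>cells_is_block\<close>): every cell of the set off the arrow consumes one unit of flow, and flow runs
  only between adjacent cells of the set, so a part that is not connected to the arrow cell could not be
  supplied (\<open>no_flow_across_cut\<close>). Hence the sets of active indices are exactly the blocks. The
  ordering constraint says that they are met along the arrow in the order of their numbers
  (\<open>blocks_along_eq\<close>), and the evolution constraints select one translation that carries each set
  into the next, which has exactly one more cell (\<open>cells_evolve\<close>).

  Conversely, the blocks of a valid solution define all variables. A block stays inside the region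
  of its arrow (\<open>block_subset_reach\<close>), since it cannot take up a shaded cell, and a cell of another
  arrow or one next to a pre-drawn square there would lead to a second arrow cell in the block.
  There are at most \<open>max_blocks a\<close> blocks, since no two consecutive cells of an arrow carry squares.
  The translation between consecutive blocks belongs to the restricted index set because distinct
  blocks neither overlap nor touch (\<open>block_translation\<close>). Finally, a connected block carries a flow
  that leaves one unit in every cell and never exceeds the size of the block on any arc
  (\<open>spanning_flow_exists\<close>), which is below the bound \<open>M\<close>.
\<close>

section \<open>Cells and coordinates\<close>

lemma finite_board: "finite (board E)"
  by (simp add: board_def)

lemma cell_number:
  assumes "i \<in> board E"
  shows "int i = (int (row_of E i) - 1) * int (ncols E) + int (col_of E i)"
proof -
  have "i - 1 = (i - 1) div ncols E * ncols E + (i - 1) mod ncols E"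
    by simp
  then have "int (i - 1) = int ((i - 1) div ncols E) * int (ncols E) + int ((i - 1) mod ncols E)"
    by (metis of_nat_add of_nat_mult)
  with assms show ?thesis
    by (auto simp: row_of_def col_of_def board_def of_nat_diff)
qed

lemma coordinate_bounds:
  assumes "i \<in> board E"
  shows "1 \<le> row_of E i" "row_of E i \<le> nrows E" "1 \<le> col_of E i" "col_of E i \<le> ncols E"
proof -
  have i: "1 \<le> i" "i \<le> nrows E * ncols E" using assms by (auto simp: board_def)
  then have n: "0 < ncols E" by (cases "ncols E") auto
  show "1 \<le> row_of E i" "1 \<le> col_of E i" by (auto simp: row_of_def col_of_def)
  show "col_of E i \<le> ncols E" using n by (simp add: col_of_def Suc_le_eq)
  have "(i - 1) div ncols E < nrows E"
    using i n by (simp add: div_less_iff_less_mult)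
  then show "row_of E i \<le> nrows E" by (simp add: row_of_def)
qed

text \<open>Uniqueness of division with remainder, read off in coordinates: a pair in range is the
coordinate pair of exactly the cell with the corresponding row-by-row number.\<close>

lemma cell_at:
  fixes r s :: int
  assumes r: "1 \<le> r" "r \<le> int (nrows E)" and s: "1 \<le> s" "s \<le> int (ncols E)"
    and i: "int i = (r - 1) * int (ncols E) + s"
  shows "i \<in> board E" "int (row_of E i) = r" "int (col_of E i) = s"
proof -
  obtain r' where r': "r = 1 + int r'" using zle_iff_zadd r(1) by blast
  obtain s' where s': "s = 1 + int s'" using zle_iff_zadd s(1) by blast
  have lt: "s' < ncols E" using s(2) s' by simp
  have "int i = int (r' * ncols E + s' + 1)" using i r' s' by (simp add: algebra_simps)
  then have i': "i = r' * ncols E + s' + 1" by (simp only: of_nat_eq_iff)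
  show "int (row_of E i) = r" "int (col_of E i) = s"
    using lt by (auto simp: row_of_def col_of_def i' r' s')
  have "Suc r' \<le> nrows E" using r(2) r' by simp
  then have "Suc r' * ncols E \<le> nrows E * ncols E" by (rule mult_le_mono1)
  then show "i \<in> board E" using lt by (simp add: board_def i')
qed

lemma cell_eqI:
  assumes "i \<in> board E" "j \<in> board E" "row_of E i = row_of E j" "col_of E i = col_of E j"
  shows "i = j"
  using cell_number[OF assms(1)] cell_number[OF assms(2)] assms(3,4) by simp

lemma inj_on_coordinates: "inj_on (\<lambda>i. (int (row_of E i), int (col_of E i))) (board E)"
  using cell_eqI by (auto intro!: inj_onI)

text \<open>Arithmetic on cell numbers moves a cell geometrically only as long as the target stays
inside the board; a horizontal step over the edge would wrap around into the next row.\<close>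

lemma shift_cell:
  assumes i: "i \<in> board E"
    and p: "1 \<le> int (row_of E i) + p" "int (row_of E i) + p \<le> int (nrows E)"
    and q: "1 \<le> int (col_of E i) + q" "int (col_of E i) + q \<le> int (ncols E)"
  shows "shift E i p q \<in> board E" "int (row_of E (shift E i p q)) = int (row_of E i) + p"
    "int (col_of E (shift E i p q)) = int (col_of E i) + q"
proof -
  have *: "int i + p * int (ncols E) + q
      = (int (row_of E i) + p - 1) * int (ncols E) + (int (col_of E i) + q)"
    using cell_number[OF i] by (simp add: algebra_simps)
  have "0 \<le> (int (row_of E i) + p - 1) * int (ncols E)"
    using p(1) by (intro mult_nonneg_nonneg) auto
  then have "int (shift E i p q) = (int (row_of E i) + p - 1) * int (ncols E) + (int (col_of E i) + q)"
    using * q(1) unfolding shift_def by simp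
  from cell_at[OF p q this]
  show "shift E i p q \<in> board E" "int (row_of E (shift E i p q)) = int (row_of E i) + p"
    "int (col_of E (shift E i p q)) = int (col_of E i) + q" .
qed

lemma shift_eq:
  assumes i: "i \<in> board E" and j: "j \<in> board E"
    and r: "int (row_of E j) = int (row_of E i) + p" and c: "int (col_of E j) = int (col_of E i) + q"
  shows "shift E i p q = j"
proof -
  note b = coordinate_bounds[OF j]
  have "1 \<le> int (row_of E i) + p" "int (row_of E i) + p \<le> int (nrows E)"
    "1 \<le> int (col_of E i) + q" "int (col_of E i) + q \<le> int (ncols E)"
    using b r c by linarith+
  note s = shift_cell[OF i this]
  have "row_of E (shift E i p q) = row_of E j" "col_of E (shift E i p q) = col_of E j"
    using s(2,3) r c by linarith+
  then show ?thesis using cell_eqI s(1) j by blast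
qed

lemma adjacent_sym: "adjacent E i j \<longleftrightarrow> adjacent E j i"
  by (auto simp: adjacent_def abs_minus_commute)

lemma adjacent_right:
  assumes "i \<in> board E" "col_of E i < ncols E"
  shows "adjacent E i (i + 1)"
proof -
  have "shift E i 0 1 = i + 1" by (simp add: shift_def nat_add_distrib)
  then show ?thesis
    using shift_cell[of i E 0 1] coordinate_bounds[OF assms(1)] assms
    by (auto simp: adjacent_def)
qed

lemma adjacent_below:
  assumes "i \<in> board E" "row_of E i < nrows E"
  shows "adjacent E i (i + ncols E)"
proof -
  have "shift E i 1 0 = i + ncols E" by (simp add: shift_def nat_add_distrib)
  then show ?thesis
    using shift_cell[of i E 1 0] coordinate_bounds[OF assms(1)] assms
    by (auto simp: adjacent_def)
qed

text \<open>The system separates blocks by looking only at the right and lower neighbour of each cell.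
Up to exchanging the two cells, these are all the adjacencies there are.\<close>

lemma adjacent_cases [consumes 1]:
  assumes "adjacent E i j"
  obtains "col_of E i < ncols E" "j = i + 1" | "row_of E i < nrows E" "j = i + ncols E"
    | "col_of E j < ncols E" "i = j + 1" | "row_of E j < nrows E" "i = j + ncols E"
proof -
  have i: "i \<in> board E" and j: "j \<in> board E"
    and d: "\<bar>int (row_of E i) - int (row_of E j)\<bar> + \<bar>int (col_of E i) - int (col_of E j)\<bar> = 1"
    using assms by (auto simp: adjacent_def)
  note bi = coordinate_bounds[OF i] and bj = coordinate_bounds[OF j]
  have right: "v = u + 1" if "u \<in> board E" "v \<in> board E" "row_of E v = row_of E u"
      "col_of E v = col_of E u + 1" for u v
    using shift_eq[OF that(1,2), of 0 1] that(3,4) by (simp add: shift_def nat_add_distrib)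
  have below: "v = u + ncols E" if "u \<in> board E" "v \<in> board E" "row_of E v = row_of E u + 1"
      "col_of E v = col_of E u" for u v
    using shift_eq[OF that(1,2), of 1 0] that(3,4) by (simp add: shift_def nat_add_distrib)
  have "row_of E j = row_of E i \<and> col_of E j = col_of E i + 1
      \<or> row_of E j = row_of E i + 1 \<and> col_of E j = col_of E i
      \<or> row_of E i = row_of E j \<and> col_of E i = col_of E j + 1
      \<or> row_of E i = row_of E j + 1 \<and> col_of E i = col_of E j"
  proof -
    have "p = 0 \<and> (q = 1 \<or> q = -1) \<or> (p = 1 \<or> p = -1) \<and> q = 0"
      if "\<bar>p\<bar> + \<bar>q\<bar> = 1" for p q :: int
      using that by arith
    from this[OF d] show ?thesis
      by (elim disjE conjE) simp_all
  qed
  then consider "row_of E j = row_of E i" "col_of E j = col_of E i + 1"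
    | "row_of E j = row_of E i + 1" "col_of E j = col_of E i"
    | "row_of E i = row_of E j" "col_of E i = col_of E j + 1"
    | "row_of E i = row_of E j + 1" "col_of E i = col_of E j"
    by blast
  then show thesis
  proof cases
    case 1 with that(1) right[OF i j] bj show ?thesis by simp
  next
    case 2 with that(2) below[OF i j] bj show ?thesis by simp
  next
    case 3 with that(3) right[OF j i] bi show ?thesis by simp
  next
    case 4 with that(4) below[OF j i] bi show ?thesis by simp
  qed
qed

section \<open>Blocks as connected components\<close>

lemma block_of_refl: "i \<in> block_of E Q i"
  by (simp add: block_of_def)

lemma block_of_subset:
  assumes "i \<in> Q" shows "block_of E Q i \<subseteq> Q"
proof
  fix j assume "j \<in> block_of E Q i"
  then have "(\<lambda>u v. u \<in> Q \<and> v \<in> Q \<and> adjacent E u v)\<^sup>*\<^sup>* i j" by (simp add: block_of_def)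
  then show "j \<in> Q" using assms by (induction rule: rtranclp_induct) auto
qed

lemma block_of_eq:
  assumes "j \<in> block_of E Q i" shows "block_of E Q j = block_of E Q i"
proof -
  have "symp (\<lambda>u v. u \<in> Q \<and> v \<in> Q \<and> adjacent E u v)"
    using adjacent_sym by (auto simp: symp_def)
  then have "symp (\<lambda>u v. u \<in> Q \<and> v \<in> Q \<and> adjacent E u v)\<^sup>*\<^sup>*"
    by (rule symp_rtranclp)
  then show ?thesis
    using assms unfolding block_of_def by (auto intro: rtranclp_trans dest: sympD)
qed

lemma block_of_step:
  assumes "j \<in> block_of E Q i" "j \<in> Q" "k \<in> Q" "adjacent E j k"
  shows "k \<in> block_of E Q i"
  using assms unfolding block_of_def by (auto intro: rtranclp.rtrancl_into_rtrancl)

text \<open>To bound a block from above it is enough to exhibit a set that no step inside \<open>Q\<close> leaves.\<close>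

lemma block_of_least:
  assumes "i \<in> B" and "\<And>u v. u \<in> B \<Longrightarrow> v \<in> Q \<Longrightarrow> adjacent E u v \<Longrightarrow> v \<in> B"
  shows "block_of E Q i \<subseteq> B"
proof
  fix j assume "j \<in> block_of E Q i"
  then have "(\<lambda>u v. u \<in> Q \<and> v \<in> Q \<and> adjacent E u v)\<^sup>*\<^sup>* i j" by (simp add: block_of_def)
  then show "j \<in> B" using assms by (induction rule: rtranclp_induct) auto
qed

section \<open>Flows\<close>

text \<open>The net inflows of the members of \<open>T\<close> add up to the net flow into \<open>T\<close>, because an arc inside
\<open>T\<close> is counted once with either sign. This is what makes a flow prove connectivity: a part of a
block without its source consumes a positive amount, so something must enter it.\<close>

lemma no_flow_across_cut:
  fixes f :: "'a \<Rightarrow> 'a \<Rightarrow> int"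
  assumes V: "finite V" and T: "T \<subseteq> V"
    and nb: "\<And>i. nb i = {j \<in> V. R i j}" and sym: "\<And>i j. R i j = R j i"
    and cut: "\<And>i j. i \<in> T \<Longrightarrow> j \<in> V - T \<Longrightarrow> R i j \<Longrightarrow> f i j = 0 \<and> f j i = 0"
  shows "(\<Sum>i\<in>T. (\<Sum>j\<in>nb i. f j i) - (\<Sum>j\<in>nb i. f i j)) = 0"
proof -
  define g where "g i j = (if R i j then f i j else 0)" for i j
  have inside: "(\<Sum>j\<in>nb i. h j) = (\<Sum>j\<in>T. if R i j then h j else 0)"
    if "\<And>j. j \<in> V - T \<Longrightarrow> R i j \<Longrightarrow> h j = 0" for i and h :: "'a \<Rightarrow> int"
  proof -
    have "(\<Sum>j\<in>nb i. h j) = (\<Sum>j\<in>V. if R i j then h j else 0)"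
      using V by (simp add: nb sum.inter_filter)
    also have "\<dots> = (\<Sum>j\<in>T. if R i j then h j else 0)"
      using V T that by (intro sum.mono_neutral_right) auto
    finally show ?thesis .
  qed
  have "(\<Sum>j\<in>nb i. f j i) = (\<Sum>j\<in>T. g j i)" "(\<Sum>j\<in>nb i. f i j) = (\<Sum>j\<in>T. g i j)"
    if "i \<in> T" for i
  proof -
    show "(\<Sum>j\<in>nb i. f j i) = (\<Sum>j\<in>T. g j i)"
      unfolding g_def sym[of _ i] by (rule inside) (use cut[OF that] in blast)
    show "(\<Sum>j\<in>nb i. f i j) = (\<Sum>j\<in>T. g i j)"
      unfolding g_def by (rule inside) (use cut[OF that] in blast)
  qed
  then have "(\<Sum>i\<in>T. (\<Sum>j\<in>nb i. f j i) - (\<Sum>j\<in>nb i. f i j))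
      = (\<Sum>i\<in>T. \<Sum>j\<in>T. g j i) - (\<Sum>i\<in>T. \<Sum>j\<in>T. g i j)"
    by (simp add: sum_subtractf)
  also have "\<dots> = 0" by (subst sum.swap) simp
  finally show ?thesis .
qed

text \<open>One unit travels from \<open>r\<close> to \<open>u\<close> along arcs of \<open>R\<close>, balanced at every vertex of \<open>B\<close>. The
region \<open>S\<close> that contains the arcs is a separate parameter so that routes can be extended to
new vertices without reusing an arc, which keeps all values in \<open>{0, 1}\<close>.\<close>

definition unit_flow :: "('a \<Rightarrow> 'a \<Rightarrow> bool) \<Rightarrow> 'a set \<Rightarrow> 'a set \<Rightarrow> 'a \<Rightarrow> 'a \<Rightarrow> ('a \<Rightarrow> 'a \<Rightarrow> int) \<Rightarrow> bool"
  where "unit_flow R B S r u g \<longleftrightarrow>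
    (\<forall>i j. g i j \<in> {0, 1} \<and> (g i j \<noteq> 0 \<longrightarrow> i \<in> S \<and> j \<in> S \<and> R i j)) \<and>
    (\<forall>i\<in>B. (\<Sum>j\<in>B. g j i) - (\<Sum>j\<in>B. g i j) = of_bool (i = u) - of_bool (i = r))"

text \<open>A vertex outside the region is reached by appending one arc, which the old route cannot have
used already.\<close>

lemma unit_flow_extend:
  assumes g: "unit_flow R B S r u g" and B: "finite B" "S \<subseteq> B"
    and u: "u \<in> S" and v: "v \<in> B - S" and R: "R u v"
  shows "\<exists>g. unit_flow R B (insert v S) r v g"
proof -
  define e :: "'a \<Rightarrow> 'a \<Rightarrow> int" where "e i j = of_bool (i = u) * of_bool (j = v)" for i j
  have uB: "u \<in> B" and vB: "v \<in> B" and vS: "v \<notin> S" using u v B by auto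
  have in_e: "(\<Sum>j\<in>B. e j i) = of_bool (i = v)" and out_e: "(\<Sum>j\<in>B. e i j) = of_bool (i = u)" for i
    unfolding e_def using B uB vB
    by (cases "i = v"; cases "i = u"; simp add: of_bool_def)+
  have vals: "g i j \<in> {0, 1}" "g i j \<noteq> 0 \<Longrightarrow> i \<in> S \<and> j \<in> S \<and> R i j" for i j
    using g unfolding unit_flow_def by blast+
  have bal: "(\<Sum>j\<in>B. g j i) - (\<Sum>j\<in>B. g i j) = of_bool (i = u) - of_bool (i = r)" if "i \<in> B" for i
    using g that unfolding unit_flow_def by blast
  have guv: "g u v = 0" using vals(2)[of u v] vS by auto
  have "g i j + e i j \<in> {0, 1}" for i j
    using vals(1)[of i j] guv by (auto simp: e_def)
  moreover have "i \<in> insert v S \<and> j \<in> insert v S \<and> R i j" if "g i j + e i j \<noteq> 0" for i j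
  proof (cases "i = u \<and> j = v")
    case True then show ?thesis using u R by auto
  next
    case False
    then have "e i j = 0" by (auto simp: e_def)
    then show ?thesis using that vals(2)[of i j] by auto
  qed
  moreover have "(\<Sum>j\<in>B. g j i + e j i) - (\<Sum>j\<in>B. g i j + e i j) = of_bool (i = v) - of_bool (i = r)"
    if "i \<in> B" for i
    using bal[OF that] by (simp add: sum.distrib in_e out_e)
  ultimately have "unit_flow R B (insert v S) r v (\<lambda>i j. g i j + e i j)"
    unfolding unit_flow_def by blast
  then show ?thesis by blast
qed

lemma unit_flow_mono: "unit_flow R B S r u g \<Longrightarrow> S \<subseteq> S' \<Longrightarrow> unit_flow R B S' r u g"
  unfolding unit_flow_def by blast

text \<open>The region reached from the source is enlarged one vertex at a time; connectivity, in the form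
that every proper part containing \<open>r\<close> has an outgoing arc, keeps this going until all of \<open>B\<close> is
reached.\<close>

lemma unit_flows_exist:
  assumes B: "finite B" and r: "r \<in> B"
    and conn: "\<And>S. r \<in> S \<Longrightarrow> S \<subset> B \<Longrightarrow> \<exists>u\<in>S. \<exists>v\<in>B - S. R u v"
  shows "\<forall>u\<in>B. \<exists>g. unit_flow R B B r u g"
proof -
  have "\<forall>u\<in>B. \<exists>g. unit_flow R B B r u g"
    if "r \<in> S" "S \<subseteq> B" "\<forall>u\<in>S. \<exists>g. unit_flow R B S r u g" for S
    using that
  proof (induction "card (B - S)" arbitrary: S rule: less_induct)
    case less
    show ?case
    proof (cases "S = B")
      case True with less.prems show ?thesis by simp
    next
      case False
      then obtain u v where u: "u \<in> S" and v: "v \<in> B - S" and R: "R u v"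
        using conn[of S] less.prems by blast
      obtain g where g: "unit_flow R B S r u g" using less.prems u by blast
      have "\<exists>g. unit_flow R B (insert v S) r w g" if "w \<in> insert v S" for w
      proof (cases "w = v")
        case True
        with unit_flow_extend[OF g B less.prems(2) u v R] show ?thesis by simp
      next
        case False
        then have "w \<in> S" using that by simp
        then obtain h where "unit_flow R B S r w h" using less.prems(3) by blast
        then have "unit_flow R B (insert v S) r w h"
          by (rule unit_flow_mono[OF _ subset_insertI])
        then show ?thesis by blast
      qed
      moreover have "card (B - insert v S) < card (B - S)"
        using B v by (intro psubset_card_mono) auto
      ultimately show ?thesis
        using less.hyps[of "insert v S"] less.prems(1,2) v by simp
    qed
  qed
  moreover have "unit_flow R B {r} r r (\<lambda>_ _. 0)" by (simp add: unit_flow_def)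
  ultimately show ?thesis using r by blast
qed

text \<open>Superposing one unit route per vertex lets each vertex consume one unit. An arc is used at most
once per route, so no arc carries more than the size of \<open>B\<close>; with this bound the flow respects
the capacity \<open>M\<close> of the system.\<close>

lemma spanning_flow_exists:
  assumes B: "finite B" and r: "r \<in> B"
    and conn: "\<And>S. r \<in> S \<Longrightarrow> S \<subset> B \<Longrightarrow> \<exists>u\<in>S. \<exists>v\<in>B - S. R u v"
  shows "\<exists>f. (\<forall>i j. 0 \<le> f i j \<and> f i j \<le> int (card B)) \<and>
    (\<forall>i j. f i j \<noteq> 0 \<longrightarrow> i \<in> B \<and> j \<in> B \<and> R i j) \<and>
    (\<forall>i\<in>B. (\<Sum>j\<in>B. f j i) - (\<Sum>j\<in>B. f i j) = 1 - (if i = r then int (card B) else 0))"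
proof -
  obtain g where g: "\<And>u. u \<in> B \<Longrightarrow> unit_flow R B B r u (g u)"
    using unit_flows_exist[OF assms] by metis
  have vals: "g u i j \<in> {0, 1}" "g u i j \<noteq> 0 \<Longrightarrow> i \<in> B \<and> j \<in> B \<and> R i j" if "u \<in> B" for u i j
    using g[OF that] unfolding unit_flow_def by blast+
  have bal: "(\<Sum>j\<in>B. g u j i) - (\<Sum>j\<in>B. g u i j) = of_bool (i = u) - of_bool (i = r)"
    if "u \<in> B" "i \<in> B" for u i
    using g[OF that(1)] that(2) unfolding unit_flow_def by blast
  define f where "f i j = (\<Sum>u\<in>B. g u i j)" for i j
  have range: "0 \<le> g u i j" "g u i j \<le> 1" if "u \<in> B" for u i j
    using vals(1)[OF that, of i j] by auto
  have "0 \<le> f i j" for i j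
    unfolding f_def using range by (intro sum_nonneg)
  moreover have "f i j \<le> int (card B)" for i j
  proof -
    have "f i j \<le> (\<Sum>u\<in>B. 1)" unfolding f_def using range by (intro sum_mono)
    then show ?thesis by simp
  qed
  moreover have "i \<in> B \<and> j \<in> B \<and> R i j" if nz: "f i j \<noteq> 0" for i j
  proof -
    obtain u where "u \<in> B" "g u i j \<noteq> 0"
      using nz sum.neutral[of B "\<lambda>u. g u i j"] unfolding f_def by blast
    then show ?thesis by (rule vals(2))
  qed
  moreover have "(\<Sum>j\<in>B. f j i) - (\<Sum>j\<in>B. f i j) = 1 - (if i = r then int (card B) else 0)"
    if i: "i \<in> B" for i
  proof -
    have "(\<Sum>j\<in>B. f j i) - (\<Sum>j\<in>B. f i j)
        = (\<Sum>u\<in>B. (\<Sum>j\<in>B. g u j i) - (\<Sum>j\<in>B. g u i j))"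
      unfolding f_def sum_subtractf by (intro arg_cong2[where f = "(-)"] sum.swap)
    also have "\<dots> = (\<Sum>u\<in>B. of_bool (i = u) - of_bool (i = r))"
      using bal i by (intro sum.cong) auto
    also have "\<dots> = 1 - (if i = r then int (card B) else 0)"
      using B i by (simp add: sum_subtractf of_bool_def)
    finally show ?thesis .
  qed
  ultimately show ?thesis by (intro exI[of _ f]) blast
qed

section \<open>Lists\<close>

text \<open>Filtering by position makes the order of the survivors visible as an order on indices.\<close>

lemma filter_eq_map_nth: "filter P xs = map ((!) xs) (filter (\<lambda>j. P (xs ! j)) [0..<length xs])"
  using filter_map[of P "(!) xs" "[0..<length xs]"] by (simp add: map_nth comp_def)

lemma filter_keeps_order:
  assumes xs: "distinct xs" and ij: "i < j" "j < length (filter P xs)"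
    and l: "l < length xs" "xs ! l = filter P xs ! i"
    and l': "l' < length xs" "xs ! l' = filter P xs ! j"
  shows "l < l'"
proof -
  let ?is = "filter (\<lambda>j. P (xs ! j)) [0..<length xs]"
  have eq: "filter P xs = map ((!) xs) ?is" by (rule filter_eq_map_nth)
  then have len: "length (filter P xs) = length ?is" by (metis length_map)
  have "sorted_wrt (<) ?is" by (simp add: sorted_wrt_filter)
  then have "?is ! i < ?is ! j" using ij len by (simp add: sorted_wrt_iff_nth_less)
  moreover have "l = ?is ! i" "l' = ?is ! j"
  proof -
    have "?is ! k < length xs" if "k < length ?is" for k using nth_mem[OF that] by simp
    moreover have "filter P xs ! k = xs ! (?is ! k)" if "k < length ?is" for k
      using eq that by (metis nth_map)
    ultimately show "l = ?is ! i" "l' = ?is ! j"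
      using l l' ij len xs by (simp_all add: nth_eq_iff_index_eq)
  qed
  ultimately show ?thesis by simp
qed

lemma length_filter_le_half:
  assumes "successively (\<lambda>u v. \<not> (P u \<and> P v)) xs"
  shows "length (filter P xs) \<le> (length xs + 1) div 2"
  using assms
proof (induction xs rule: induct_list012)
  case (3 u v zs)
  have "successively (\<lambda>u v. \<not> (P u \<and> P v)) zs" using 3(3) by (auto simp: successively_Cons)
  then show ?case using 3 by auto
qed auto

section \<open>Arrows and their regions\<close>

locale evolomino_puzzle =
  fixes E :: evolomino
  assumes inst: "evolomino_instance E"
begin

lemma finite_arrows: "finite (arrows E)"
  using inst by (simp add: evolomino_instance_def)

lemma arrow:
  assumes "a \<in> arrows E"
  shows "distinct a" "set a \<subseteq> board E" "set a \<inter> shaded E = {}" "successively (adjacent E) a"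
  using inst assms unfolding evolomino_instance_def by blast+

lemma arrows_disjoint:
  assumes "a \<in> arrows E" "a' \<in> arrows E" "i \<in> set a" "i \<in> set a'"
  shows "a = a'"
  using inst assms unfolding evolomino_instance_def by blast

lemma arrow_subset_reach: "set a \<subseteq> reach E a"
  by (auto simp: reach_def)

text \<open>Each step of the reachability relation tests the cell that it enters, so only the starting
cells escape the test.\<close>

lemma reach_cases:
  assumes "j \<in> reach E a"
  shows "j \<in> set a \<or> j \<in> board E - excluded E a"
proof -
  obtain i where i: "i \<in> set a" and "(\<lambda>u v. adjacent E u v \<and> v \<notin> excluded E a)\<^sup>*\<^sup>* i j"
    using assms by (auto simp: reach_def)
  from this(2) i show ?thesis
    by (induction rule: rtranclp_induct) (auto simp: adjacent_def)
qed

lemma reach_subset_board: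
  assumes "a \<in> arrows E" shows "reach E a \<subseteq> board E"
  using reach_cases arrow(2)[OF assms] by blast

lemma finite_reach:
  assumes "a \<in> arrows E" shows "finite (reach E a)"
  using reach_subset_board[OF assms] finite_board by (rule finite_subset)

text \<open>Other arrows are excluded from the region of \<open>a\<close>. This is how the system keeps a block from
meeting a second arrow.\<close>

lemma reach_arrow_cells:
  assumes "a \<in> arrows E" shows "reach E a \<inter> arrow_cells E = set a"
proof -
  have "j \<in> set a" if j: "j \<in> reach E a" "a' \<in> arrows E" "j \<in> set a'" for j a'
    using reach_cases[OF j(1)] j(2,3) by (auto simp: excluded_def)
  then show ?thesis
    using arrow_subset_reach[of a] assms by (auto simp: arrow_cells_def)
qed

lemma finite_shifts_of: "finite (shifts_of E a)"
proof -
  have "shifts_of E a \<subseteq> {-int (nrows E)..int (nrows E)} \<times> {-int (ncols E)..int (ncols E)}"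
    by (auto simp: shifts_of_def shifts_at_def shifts_def)
  then show ?thesis by (rule finite_subset) simp
qed

definition index :: "(nat list \<times> nat) set" where
  "index = (SIGMA a:arrows E. {1..max_blocks a})"

lemma finite_index: "finite index"
  by (simp add: index_def finite_arrows)

text \<open>This turns the first constraint of the system into a statement on how many members of a family
of sets contain a given cell. The restriction of the sum to arrows with \<open>i\<close> in their region
drops no set, because the sets lie in the regions.\<close>

lemma sum_over_index:
  assumes "\<And>a k. (a, k) \<in> index \<Longrightarrow> C (a, k) \<subseteq> reach E a"
    and v: "\<And>a k. (a, k) \<in> index \<Longrightarrow> i \<in> reach E a \<Longrightarrow> v a k = of_bool (i \<in> C (a, k))"
  shows "(\<Sum>a\<in>{a \<in> arrows E. i \<in> reach E a}. \<Sum>k=1..max_blocks a. v a k)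
    = int (card {ak \<in> index. i \<in> C ak})"
proof -
  let ?I = "SIGMA a:{a \<in> arrows E. i \<in> reach E a}. {1..max_blocks a}"
  have "(\<Sum>a\<in>{a \<in> arrows E. i \<in> reach E a}. \<Sum>k=1..max_blocks a. v a k) = (\<Sum>(a, k)\<in>?I. v a k)"
    using finite_arrows by (simp add: sum.Sigma)
  also have "\<dots> = (\<Sum>ak\<in>?I. if i \<in> C ak then 1 else 0)"
    using v by (intro sum.cong) (auto simp: index_def)
  also have "\<dots> = int (card {ak \<in> ?I. i \<in> C ak})"
    using finite_arrows by (simp flip: sum.inter_filter)
  also have "{ak \<in> ?I. i \<in> C ak} = {ak \<in> index. i \<in> C ak}"
    using assms(1) unfolding index_def by blast
  finally show ?thesis .
qed

end

text \<open>Both directions of the equivalence start from an assignment of the cell variables; they share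
the set \<open>Q\<close> of cells that carry a square.\<close>

locale cell_assignment = evolomino_puzzle +
  fixes x :: cell_var
  assumes x01: "\<And>i. i \<in> board E \<Longrightarrow> x i \<in> {0, 1}"
begin

definition Q :: "nat set" where "Q = {i \<in> board E. x i = 1}"

lemma x_eq: "i \<in> board E \<Longrightarrow> x i = of_bool (i \<in> Q)"
  using x01[of i] by (auto simp: Q_def)

end

section \<open>From a solution of the system to a solution of the puzzle\<close>

locale system_solution = cell_assignment +
  fixes M :: int and y :: y_var and b :: block_var and t :: t_var
    and N :: block_var and f :: flow_var and F :: y_var
  assumes bin: "binary_vars E y b t"
    and sys: "satisfies_system E M x y b t N f F"
begin

definition cells :: "nat list \<times> nat \<Rightarrow> nat set" where
  "cells ak = {i \<in> reach E (fst ak). y (fst ak) (snd ak) i = 1}"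

lemma clues: "clue_constraints E x b"
  and basics: "basic_constraints E M x y b N"
  and flows: "connectivity_constraints E M y N f F"
  and evolutions: "evolution_constraints E y b t"
  using sys by (auto simp: satisfies_system_def)

lemma y_eq:
  assumes "(a, k) \<in> index" "i \<in> reach E a"
  shows "y a k i = of_bool (i \<in> cells (a, k))"
proof -
  have "y a k i \<in> {0, 1}" using bin assms unfolding binary_vars_def index_def by blast
  then show ?thesis using assms(2) by (auto simp: cells_def)
qed

lemma b01:
  assumes "(a, k) \<in> index" shows "b a k \<in> {0, 1}"
  using bin assms by (auto simp: binary_vars_def index_def)

lemma cells_subset_reach: "cells (a, k) \<subseteq> reach E a"
  by (auto simp: cells_def)

lemma finite_cells: "ak \<in> index \<Longrightarrow> finite (cells ak)"
  by (cases ak) (auto intro: finite_subset[OF cells_subset_reach] finite_reach simp: index_def)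

lemma sum_y:
  assumes "(a, k) \<in> index" "A \<subseteq> reach E a"
  shows "(\<Sum>i\<in>A. y a k i) = int (card (cells (a, k) \<inter> A))"
proof -
  have fin: "finite A"
    using assms finite_reach finite_subset by (auto simp: index_def)
  have "(\<Sum>i\<in>A. y a k i) = (\<Sum>i\<in>A. of_bool (i \<in> cells (a, k)))"
    using assms y_eq by (intro sum.cong) auto
  also have "\<dots> = int (card (A \<inter> {i. i \<in> cells (a, k)}))"
    using fin by (simp add: sum.If_cases of_bool_def)
  finally show ?thesis by (simp add: Int_commute)
qed

text \<open>Since \<open>x i\<close> is binary, this makes the sets \<open>cells\<close> a partition of \<open>Q\<close>: a square lies in
exactly one of them, an empty cell in none.\<close>

lemma x_counts_cells:
  assumes "i \<in> board E"
  shows "x i = int (card {ak \<in> index. i \<in> cells ak})"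
proof -
  have "x i = (\<Sum>a\<in>{a \<in> arrows E. i \<in> reach E a}. \<Sum>k=1..max_blocks a. y a k i)"
    using basics assms by (simp add: basic_constraints_def)
  then show ?thesis
    using sum_over_index[of cells i "\<lambda>a k. y a k i"] cells_subset_reach y_eq by simp
qed

lemma cells_subset_Q:
  assumes ak: "ak \<in> index" shows "cells ak \<subseteq> Q"
proof
  fix i assume i: "i \<in> cells ak"
  then have board: "i \<in> board E"
    using ak reach_subset_board by (fastforce simp: index_def cells_def)
  have "{ak \<in> index. i \<in> cells ak} \<noteq> {}" using ak i by blast
  then have "card {ak \<in> index. i \<in> cells ak} \<noteq> 0" using finite_index by simp
  then have "x i \<noteq> 0" using x_counts_cells[OF board] by simp
  then show "i \<in> Q" using x01[OF board] board by (auto simp: Q_def)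
qed

lemma Q_in_one_cells:
  assumes "i \<in> Q" shows "\<exists>!ak. ak \<in> index \<and> i \<in> cells ak"
proof -
  have "card {ak \<in> index. i \<in> cells ak} = 1"
    using assms x_counts_cells[of i] by (simp add: Q_def)
  then obtain ak where "{ak \<in> index. i \<in> cells ak} = {ak}"
    by (rule card_1_singletonE)
  then show ?thesis by (intro ex1I[of _ ak]) blast+
qed

lemma cells_disjoint:
  assumes "ak \<in> index" "ak' \<in> index" "i \<in> cells ak" "i \<in> cells ak'"
  shows "ak = ak'"
  using Q_in_one_cells[of i] cells_subset_Q assms by blast

text \<open>The constraints on right and lower neighbours, applied to both orders of the two cells.\<close>

lemma cells_separated:
  assumes ak: "(a, k) \<in> index" "(a', k') \<in> index" "(a, k) \<noteq> (a', k')"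
    and i: "i \<in> cells (a, k)" and j: "j \<in> cells (a', k')"
  shows "\<not> adjacent E i j"
proof
  have sep: "(col_of E i < ncols E \<longrightarrow> j \<noteq> i + 1) \<and> (row_of E i < nrows E \<longrightarrow> j \<noteq> i + ncols E)"
    if "(a, k) \<in> index" "(a', k') \<in> index" "(a, k) \<noteq> (a', k')"
      "i \<in> cells (a, k)" "j \<in> cells (a', k')" for a k a' k' i j
  proof -
    have aA: "a \<in> arrows E" "a' \<in> arrows E" "k \<in> {1..max_blocks a}" "k' \<in> {1..max_blocks a'}"
      using that by (auto simp: index_def)
    have ne: "a \<noteq> a' \<or> k \<noteq> k'" using that(3) by simp
    have ij: "i \<in> reach E a" "j \<in> reach E a'" "y a k i = 1" "y a' k' j = 1"
      using that by (auto simp: cells_def)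
    have "(\<forall>i\<in>reach E a. col_of E i < ncols E \<and> i + 1 \<in> reach E a' \<longrightarrow>
             y a k i + y a' k' (i + 1) \<le> 1) \<and>
          (\<forall>i\<in>reach E a. row_of E i < nrows E \<and> i + ncols E \<in> reach E a' \<longrightarrow>
             y a k i + y a' k' (i + ncols E) \<le> 1)"
      using basics aA ne unfolding basic_constraints_def by blast
    with ij show ?thesis by force
  qed
  assume "adjacent E i j"
  then show False
    using sep[OF ak i j] sep[OF ak(2,1) ak(3)[symmetric] j i]
    by (cases rule: adjacent_cases) auto
qed

text \<open>A neighbouring square lies in some set of the partition, and separation forces it to be the
same one. So each set is a union of blocks.\<close>

lemma cells_closed:
  assumes ak: "ak \<in> index" and u: "u \<in> cells ak" and v: "v \<in> Q" and adj: "adjacent E u v"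
  shows "v \<in> cells ak"
proof -
  obtain ak' where ak': "ak' \<in> index" "v \<in> cells ak'" using Q_in_one_cells[OF v] by blast
  obtain a k a' k' where "ak = (a, k)" "ak' = (a', k')" by (cases ak; cases ak') auto
  then have "ak = ak'" using cells_separated[of a k a' k' u v] ak u adj ak' by blast
  with ak' show ?thesis by simp
qed

lemma card_arrow_cells:
  assumes ak: "(a, k) \<in> index"
  shows "int (card (cells (a, k) \<inter> set a)) = b a k"
proof -
  have "(\<Sum>i\<in>set a. y a k i) = b a k"
    using basics ak by (simp add: basic_constraints_def index_def)
  then show ?thesis using sum_y[OF ak arrow_subset_reach] by simp
qed

text \<open>An inactive index has no cell because the size constraint leaves it room for none; an active
one has a cell on its arrow.\<close>

lemma cells_active:
  assumes ak: "(a, k) \<in> index"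
  shows "b a k = 1 \<longleftrightarrow> cells (a, k) \<noteq> {}"
proof
  assume "b a k = 1"
  then show "cells (a, k) \<noteq> {}" using card_arrow_cells[OF ak] by auto
next
  assume ne: "cells (a, k) \<noteq> {}"
  have "(\<Sum>i\<in>reach E a. y a k i) \<le> M * b a k"
    using basics ak by (simp add: basic_constraints_def index_def)
  then have "int (card (cells (a, k))) \<le> M * b a k"
    using sum_y[OF ak order_refl] cells_subset_reach[of a k] by (simp add: Int_absorb2)
  then have "b a k \<noteq> 0" using ne finite_cells[OF ak] by auto
  then show "b a k = 1" using b01[OF ak] by simp
qed

lemma cells_arrow_cells:
  assumes ak: "(a, k) \<in> index"
  shows "cells (a, k) \<inter> arrow_cells E = cells (a, k) \<inter> set a"
  using reach_arrow_cells[of a] cells_subset_reach[of a k] ak by (auto simp: index_def)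

text \<open>Connectivity. Suppose that \<open>T\<close>, the part of the set not connected to its arrow cell, is
nonempty. It contains no cell of the arrow, so each of its cells consumes one unit of flow. But
nothing flows into \<open>T\<close>: flow exists only between cells of the set, and those outside \<open>T\<close> are
not adjacent to \<open>T\<close>.\<close>

lemma cells_is_block:
  assumes ak: "(a, k) \<in> index" and r: "r \<in> cells (a, k)" "r \<in> set a"
  shows "block_of E Q r = cells (a, k)"
proof
  show sub: "block_of E Q r \<subseteq> cells (a, k)"
    using r(1) cells_closed[OF ak] by (rule block_of_least)
  have a: "a \<in> arrows E" and k: "k \<in> {1..max_blocks a}" using ak by (auto simp: index_def)
  define T where "T = cells (a, k) - block_of E Q r"
  have one: "card (cells (a, k) \<inter> set a) = 1"
    using card_arrow_cells[OF ak] cells_active[OF ak] r by auto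
  have T: "T \<subseteq> reach E a - set a"
  proof
    fix i assume i: "i \<in> T"
    have "i \<notin> set a"
    proof
      assume "i \<in> set a"
      then have "i \<in> cells (a, k) \<inter> set a" "r \<in> cells (a, k) \<inter> set a"
        using i r by (auto simp: T_def)
      then have "i = r" using one by (metis card_1_singletonE singletonD)
      then show False using i block_of_refl by (auto simp: T_def)
    qed
    then show "i \<in> reach E a - set a" using i cells_subset_reach by (auto simp: T_def)
  qed
  have flow: "f a k i j \<le> M * y a k i" "f a k i j \<le> M * y a k j" "0 \<le> f a k i j"
    if "i \<in> reach E a" "j \<in> nbrs E a i" for i j
    using flows a k that unfolding connectivity_constraints_def by blast+
  have flow0: "f a k i j = 0" if "i \<in> reach E a" "j \<in> reach E a" "adjacent E i j"
    "i \<notin> cells (a, k) \<or> j \<notin> cells (a, k)" for i j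
  proof -
    have "y a k i = 0 \<or> y a k j = 0" using y_eq[OF ak] that by auto
    then show ?thesis using flow[of i j] that by (auto simp: nbrs_def)
  qed
  have "(\<Sum>i\<in>T. (\<Sum>j\<in>nbrs E a i. f a k j i) - (\<Sum>j\<in>nbrs E a i. f a k i j)) = 0"
  proof (rule no_flow_across_cut[OF finite_reach[OF a]])
    show "T \<subseteq> reach E a" using T by auto
    show "nbrs E a i = {j \<in> reach E a. adjacent E i j}" for i by (simp add: nbrs_def)
    show "adjacent E i j = adjacent E j i" for i j by (rule adjacent_sym)
    fix i j assume i: "i \<in> T" and j: "j \<in> reach E a - T" and adj: "adjacent E i j"
    have "j \<notin> cells (a, k)"
    proof
      assume j': "j \<in> cells (a, k)"
      then have "j \<in> block_of E Q r" using j by (auto simp: T_def)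
      then have "i \<in> block_of E Q r"
        using i j' adj adjacent_sym cells_subset_Q[OF ak]
        by (intro block_of_step[of j E Q r i]) (auto simp: T_def)
      then show False using i by (simp add: T_def)
    qed
    then show "f a k i j = 0 \<and> f a k j i = 0"
      using flow0 i j adj adjacent_sym T by blast
  qed
  moreover have "(\<Sum>j\<in>nbrs E a i. f a k j i) - (\<Sum>j\<in>nbrs E a i. f a k i j) = 1" if i: "i \<in> T" for i
  proof -
    have "(\<Sum>j\<in>nbrs E a i. f a k j i) - (\<Sum>j\<in>nbrs E a i. f a k i j) = y a k i"
      using flows a k T i unfolding connectivity_constraints_def by blast
    also have "\<dots> = 1" using i by (auto simp: T_def cells_def)
    finally show ?thesis .
  qed
  ultimately have "card T = 0" by simp
  moreover have "finite T" using finite_cells[OF ak] by (simp add: T_def)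
  ultimately show "cells (a, k) \<subseteq> block_of E Q r" by (auto simp: T_def)
qed

lemma arrow_cell_ex:
  assumes ak: "(a, k) \<in> index" and "b a k = 1"
  obtains l where "l < length a" "a ! l \<in> cells (a, k)"
proof -
  have "card (cells (a, k) \<inter> set a) = 1" using card_arrow_cells[OF ak] assms(2) by simp
  then obtain i where "i \<in> cells (a, k)" "i \<in> set a" by (metis IntE card_1_singletonE insertI1)
  then show thesis using that by (auto simp: in_set_conv_nth)
qed

lemma blocks_eq: "blocks E Q = {cells ak |ak. ak \<in> index \<and> cells ak \<noteq> {}}"
proof -
  have block: "\<exists>i\<in>Q. block_of E Q i = cells (a, k)"
    if ak: "(a, k) \<in> index" and ne: "cells (a, k) \<noteq> {}" for a k
  proof -
    have "b a k = 1" using cells_active[OF ak] ne by simp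
    then obtain l where "l < length a" "a ! l \<in> cells (a, k)" using arrow_cell_ex[OF ak] by blast
    then show ?thesis using cells_is_block[OF ak] cells_subset_Q[OF ak] nth_mem by blast
  qed
  show ?thesis
  proof (intro equalityI subsetI)
    fix B assume "B \<in> blocks E Q"
    then obtain i where i: "i \<in> Q" and B: "B = block_of E Q i" by (auto simp: blocks_def)
    obtain a k where ak: "(a, k) \<in> index" "i \<in> cells (a, k)" using Q_in_one_cells[OF i] by auto
    then obtain j where "block_of E Q j = cells (a, k)" using block by blast
    then have "B = cells (a, k)" using block_of_eq ak(2) B by blast
    then show "B \<in> {cells ak |ak. ak \<in> index \<and> cells ak \<noteq> {}}" using ak by blast
  next
    fix B assume "B \<in> {cells ak |ak. ak \<in> index \<and> cells ak \<noteq> {}}"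
    then obtain a k where "(a, k) \<in> index" "cells (a, k) \<noteq> {}" "B = cells (a, k)" by auto
    then show "B \<in> blocks E Q" using block unfolding blocks_def by (metis imageI)
  qed
qed

text \<open>Exactly one translation is selected. The covering constraint shows that it is admissible at
every cell of the old set, after which the image is forced into the new set. The sizes differ by
one, so the new set has exactly one further cell.\<close>

lemma cells_evolve:
  assumes ak: "(a, k) \<in> index" "2 \<le> k" and active: "b a k = 1"
  shows "evolves E (cells (a, k - 1)) (cells (a, k))"
proof -
  have a: "a \<in> arrows E" and k: "k \<in> {2..max_blocks a}" using ak by (auto simp: index_def)
  have ak': "(a, k - 1) \<in> index" using ak by (auto simp: index_def)
  let ?B = "cells (a, k - 1)" and ?B' = "cells (a, k)"
  have size: "N a k = int (card (cells (a, k)))" if "(a, k) \<in> index" for k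
  proof -
    have "N a k = (\<Sum>i\<in>reach E a. y a k i)"
      using basics that by (simp add: basic_constraints_def index_def)
    then show ?thesis
      using sum_y[OF that order_refl] cells_subset_reach[of a k] by (simp add: Int_absorb2)
  qed
  have "N a k \<ge> N a (k - 1) + 1 - M * (1 - b a k) \<and> N a k \<le> N a (k - 1) + 1 + M * (1 - b a k)"
    using basics a k unfolding basic_constraints_def by blast
  then have card: "card ?B' = Suc (card ?B)"
    using size[OF ak(1)] size[OF ak'] active by simp
  have ev: "(\<Sum>pq\<in>shifts_of E a. t a k pq) = b a k"
    "\<And>i. i \<in> reach E a \<Longrightarrow>
      (\<Sum>pq\<in>shifts_at E a i \<inter> shifts_of E a. t a k pq) \<ge> y a (k - 1) i + b a k - 1"
    "\<And>i p q. i \<in> reach E a \<Longrightarrow> (p, q) \<in> shifts_at E a i \<inter> shifts_of E a \<Longrightarrow>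
      y a k (shift E i p q) \<ge> y a (k - 1) i - (1 - t a k (p, q))"
    using evolutions a k unfolding evolution_constraints_def by blast+
  have t01: "t a k pq \<in> {0, 1}" if "pq \<in> shifts_of E a" for pq
    using bin a k that unfolding binary_vars_def by blast
  obtain p q where pq: "(p, q) \<in> shifts_of E a" "t a k (p, q) = 1"
    and only: "\<And>pq'. pq' \<in> shifts_of E a \<Longrightarrow> pq' \<noteq> (p, q) \<Longrightarrow> t a k pq' = 0"
  proof -
    have "\<exists>pq\<in>shifts_of E a. t a k pq \<noteq> 0"
      using ev(1) active sum.neutral[of "shifts_of E a" "t a k"] by (metis zero_neq_one)
    then obtain pq where pq: "pq \<in> shifts_of E a" "t a k pq = 1" using t01 by blast
    have "(\<Sum>pq'\<in>shifts_of E a - {pq}. t a k pq') = 0"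
      using ev(1) active pq finite_shifts_of by (simp add: sum_diff1)
    moreover have "\<forall>pq'\<in>shifts_of E a - {pq}. 0 \<le> t a k pq'" using t01 by force
    ultimately have "\<forall>pq'\<in>shifts_of E a - {pq}. t a k pq' = 0"
      using finite_shifts_of by (subst (asm) sum_nonneg_eq_0_iff) auto
    then show thesis using that[of "fst pq" "snd pq"] pq by auto
  qed
  have moved: "shift E i p q \<in> ?B' \<and> int (row_of E (shift E i p q)) = int (row_of E i) + p
      \<and> int (col_of E (shift E i p q)) = int (col_of E i) + q" if i: "i \<in> ?B" for i
  proof -
    have ir: "i \<in> reach E a" and yi: "y a (k - 1) i = 1" using i by (auto simp: cells_def)
    have "(p, q) \<in> shifts_at E a i"
    proof (rule ccontr)
      assume "(p, q) \<notin> shifts_at E a i"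
      then have "(\<Sum>pq\<in>shifts_at E a i \<inter> shifts_of E a. t a k pq) = 0"
        using only by (intro sum.neutral) blast
      then show False using ev(2)[OF ir] yi active by simp
    qed
    then have at: "(p, q) \<in> shifts_at E a i \<inter> shifts_of E a" using pq(1) by simp
    then have target: "shift E i p q \<in> reach E a" by (simp add: shifts_at_def)
    have "y a k (shift E i p q) \<ge> 1" using ev(3)[OF ir at] yi pq(2) by simp
    then have "shift E i p q \<in> ?B'" using y_eq[OF ak(1) target]
      by (cases "shift E i p q \<in> ?B'") auto
    moreover have "i \<in> board E" using ir reach_subset_board[OF a] by blast
    ultimately show ?thesis using at shift_cell[of i E p q] by (auto simp: shifts_at_def)
  qed
  let ?pos = "\<lambda>i. (int (row_of E i), int (col_of E i))"
  have "?B' \<subseteq> board E" "?B \<subseteq> board E"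
    using cells_subset_Q[OF ak(1)] cells_subset_Q[OF ak'] by (auto simp: Q_def)
  then have inj: "inj_on ?pos ?B'" "inj_on ?pos ?B"
    by (auto intro: inj_on_subset[OF inj_on_coordinates])
  let ?S = "(\<lambda>(r, s). (r + p, s + q)) ` coords E ?B"
  have sub: "?S \<subseteq> coords E ?B'"
  proof
    fix z assume "z \<in> ?S"
    then obtain i where i: "i \<in> ?B" and z: "z = (int (row_of E i) + p, int (col_of E i) + q)"
      by (auto simp: coords_def)
    then have "z = ?pos (shift E i p q)" using moved[OF i] by simp
    then show "z \<in> coords E ?B'" using moved[OF i] unfolding coords_def by blast
  qed
  have fin: "finite (coords E ?B')" using finite_cells[OF ak(1)] by (simp add: coords_def)
  have "card (coords E ?B') = Suc (card ?S)"
  proof -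
    have "card ?S = card (coords E ?B)" by (rule card_image) (auto simp: inj_on_def)
    then show ?thesis using inj card by (simp add: coords_def card_image)
  qed
  then have "card (coords E ?B' - ?S) = 1"
    using sub fin by (simp add: card_Diff_subset finite_subset)
  then obtain c where "coords E ?B' - ?S = {c}" by (rule card_1_singletonE)
  then have "c \<notin> ?S" "coords E ?B' = insert c ?S" using sub by blast+
  then show ?thesis unfolding evolves_def by blast
qed

text \<open>The ordering constraint at the cell \<open>a ! l\<close> rules out \<open>l' < l\<close>, and \<open>l' = l\<close> would contradict
the disjointness of the two sets.\<close>

lemma cells_in_order:
  assumes ak: "(a, k) \<in> index" "2 \<le> k"
    and l: "l < length a" "a ! l \<in> cells (a, k - 1)"
    and l': "l' < length a" "a ! l' \<in> cells (a, k)"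
  shows "l < l'"
proof (rule ccontr)
  assume "\<not> l < l'"
  have ak': "(a, k - 1) \<in> index" using ak by (auto simp: index_def)
  have a: "a \<in> arrows E" and k: "k \<in> {2..max_blocks a}" using ak by (auto simp: index_def)
  have "l \<noteq> l'"
  proof
    assume "l = l'"
    then have "(a, k - 1) = (a, k)" using cells_disjoint[OF ak' ak(1)] l(2) l'(2) by blast
    then show False using ak(2) by simp
  qed
  with \<open>\<not> l < l'\<close> have "a ! l' \<in> preceding a (a ! l)"
    using l(1) unfolding preceding_def by (intro CollectI exI[of _ l'] exI[of _ l]) auto
  moreover have sub: "preceding a (a ! l) \<subseteq> reach E a"
    using arrow_subset_reach[of a] by (force simp: preceding_def)
  ultimately have "a ! l' \<in> cells (a, k) \<inter> preceding a (a ! l)" using l'(2) by blast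
  then have "card (cells (a, k) \<inter> preceding a (a ! l)) \<noteq> 0"
    using finite_cells[OF ak(1)] by auto
  moreover have "(\<Sum>j\<in>preceding a (a ! l). y a k j) \<le> 1 - y a (k - 1) (a ! l)"
    using basics a k nth_mem[OF l(1)] unfolding basic_constraints_def by blast
  moreover have "y a (k - 1) (a ! l) = 1" using l(2) by (simp add: cells_def)
  ultimately show False using sum_y[OF ak(1) sub] by simp
qed

text \<open>Monotonicity of the activation variables makes the active indices an initial segment; the
first two are active by the clue constraints.\<close>

lemma active_prefix:
  assumes a: "a \<in> arrows E"
  obtains L where "2 \<le> L" "L \<le> max_blocks a" "\<forall>k\<in>{1..max_blocks a}. b a k = 1 \<longleftrightarrow> k \<le> L"
proof -
  let ?S = "{k \<in> {1..max_blocks a}. b a k = 1}"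
  have two: "2 \<le> max_blocks a" "b a 2 = 1" using clues a by (auto simp: clue_constraints_def)
  have mono: "b a k = 1" if "k \<le> k'" "k \<in> {1..max_blocks a}" "k' \<le> max_blocks a" "b a k' = 1" for k k'
    using that
  proof (induction k' rule: dec_induct)
    case base then show ?case by simp
  next
    case (step n)
    have idx: "(a, n) \<in> index" "(a, Suc n) \<in> index" using a step by (auto simp: index_def)
    have "Suc n \<in> {2..max_blocks a}" using step by auto
    then have "b a (Suc n) \<le> b a (Suc n - 1)"
      using basics a unfolding basic_constraints_def by blast
    then have "b a n = 1" using step b01[OF idx(1)] by auto
    then show ?case using step by simp
  qed
  define L where "L = Max ?S"
  have S: "finite ?S" "2 \<in> ?S" using two by auto
  have L: "L \<in> ?S" unfolding L_def using Max_in[OF S(1)] S(2) by blast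
  have "2 \<le> L" unfolding L_def using S by (rule Max_ge)
  moreover have "\<forall>k\<in>{1..max_blocks a}. b a k = 1 \<longleftrightarrow> k \<le> L"
  proof (intro ballI iffI)
    fix k assume k: "k \<in> {1..max_blocks a}"
    assume "b a k = 1"
    then show "k \<le> L" unfolding L_def using k by (intro Max_ge[OF S(1)]) simp
  next
    fix k assume k: "k \<in> {1..max_blocks a}" and "k \<le> L"
    then show "b a k = 1" using mono[of k L] k L by simp
  qed
  ultimately show thesis using that[of L] L by simp
qed

text \<open>Each active set meets the arrow in one position, and these positions increase with the index.
The positions of squares along the arrow, listed in increasing order, are the same set, so the
two lists of positions agree.\<close>

lemma blocks_along_eq:
  assumes a: "a \<in> arrows E" and L: "L \<le> max_blocks a"
    and active: "\<forall>k\<in>{1..max_blocks a}. b a k = 1 \<longleftrightarrow> k \<le> L"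
  shows "blocks_along E Q a = map (\<lambda>k. cells (a, k)) [1..<Suc L]"
proof -
  have idx: "(a, k) \<in> index" "b a k = 1" if "1 \<le> k" "k \<le> L" for k
    using a L that active by (auto simp: index_def)
  have "\<forall>k\<in>{1..L}. \<exists>l < length a. a ! l \<in> cells (a, k)"
  proof
    fix k assume "k \<in> {1..L}"
    then have k: "1 \<le> k" "k \<le> L" by auto
    show "\<exists>l < length a. a ! l \<in> cells (a, k)"
      using arrow_cell_ex[OF idx[OF k]] by blast
  qed
  then obtain l where l: "\<And>k. k \<in> {1..L} \<Longrightarrow> l k < length a \<and> a ! l k \<in> cells (a, k)"
    by metis
  have "successively (<) (map l [1..<Suc L])"
    unfolding successively_conv_nth
  proof (intro allI impI)
    fix i assume "Suc i < length (map l [1..<Suc L])"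
    then have i: "Suc (Suc i) \<le> L" by (simp del: upt_Suc)
    have "l (Suc i) < l (Suc (Suc i))"
    proof (rule cells_in_order)
      show "(a, Suc (Suc i)) \<in> index" using i by (intro idx) simp_all
      show "2 \<le> Suc (Suc i)" by simp
      show "l (Suc i) < length a" "a ! l (Suc i) \<in> cells (a, Suc (Suc i) - 1)"
        using l[of "Suc i"] i by simp_all
      show "l (Suc (Suc i)) < length a" "a ! l (Suc (Suc i)) \<in> cells (a, Suc (Suc i))"
        using l[of "Suc (Suc i)"] i by simp_all
    qed
    then show "map l [1..<Suc L] ! i < map l [1..<Suc L] ! Suc i"
      using i by (simp del: upt_Suc)
  qed
  then have sorted: "sorted_wrt (<) (map l [1..<Suc L])"
    by (simp add: successively_conv_sorted_wrt del: upt_Suc)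
  have set: "{j. j < length a \<and> a ! j \<in> Q} = l ` {1..L}"
  proof (intro equalityI subsetI)
    fix j assume "j \<in> {j. j < length a \<and> a ! j \<in> Q}"
    then have j: "j < length a" "a ! j \<in> Q" by auto
    obtain a' k where ak: "(a', k) \<in> index" "a ! j \<in> cells (a', k)"
      using Q_in_one_cells[OF j(2)] by auto
    have "a ! j \<in> cells (a', k) \<inter> arrow_cells E"
      using a nth_mem[OF j(1)] ak unfolding arrow_cells_def by blast
    then have "a ! j \<in> set a'" using cells_arrow_cells[OF ak(1)] by blast
    then have "a' = a" using arrows_disjoint[of a' a "a ! j"] a ak(1) j by (auto simp: index_def)
    then have k: "k \<in> {1..L}"
      using ak cells_active[OF ak(1)] active by (auto simp: index_def)
    \<comment> \<open>A set meets its arrow only once, so the square at position j is the chosen one.\<close>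
    have "card (cells (a, k) \<inter> set a) = 1"
      using card_arrow_cells[of a k] idx k by simp
    moreover have "a ! j \<in> cells (a, k) \<inter> set a" "a ! l k \<in> cells (a, k) \<inter> set a"
      using ak \<open>a' = a\<close> j l[OF k] by auto
    ultimately have "a ! j = a ! l k" by (metis card_1_singletonE singletonD)
    then have "j = l k" using arrow(1)[OF a] j l[OF k] nth_eq_iff_index_eq by blast
    then show "j \<in> l ` {1..L}" using k by blast
  next
    fix j assume "j \<in> l ` {1..L}"
    then show "j \<in> {j. j < length a \<and> a ! j \<in> Q}"
      using l idx(1) cells_subset_Q by force
  qed
  \<comment> \<open>Two strictly increasing lists with the same elements are equal.\<close>
  have "map l [1..<Suc L] = filter (\<lambda>j. a ! j \<in> Q) [0..<length a]"
  proof (rule sorted_distinct_set_unique)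
    show "sorted (map l [1..<Suc L])" "distinct (map l [1..<Suc L])"
      using sorted strict_sorted_iff by blast+
    show "sorted (filter (\<lambda>j. a ! j \<in> Q) [0..<length a])" "distinct (filter (\<lambda>j. a ! j \<in> Q) [0..<length a])"
      by (simp_all add: sorted_wrt_filter)
    show "set (map l [1..<Suc L]) = set (filter (\<lambda>j. a ! j \<in> Q) [0..<length a])"
      using set by (auto simp: atLeastLessThanSuc_atLeastAtMost simp del: upt_Suc)
  qed
  then have "filter (\<lambda>i. i \<in> Q) a = map ((!) a) (map l [1..<Suc L])"
    by (rule ssubst) (rule filter_eq_map_nth)
  then have "blocks_along E Q a = map (\<lambda>k. block_of E Q (a ! l k)) [1..<Suc L]"
    by (simp add: blocks_along_def comp_def del: upt_Suc)
  also have "\<dots> = map (\<lambda>k. cells (a, k)) [1..<Suc L]"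
  proof (rule map_cong[OF refl])
    fix k assume "k \<in> set [1..<Suc L]"
    then have "1 \<le> k" "k \<le> L" by auto
    then show "block_of E Q (a ! l k) = cells (a, k)"
      using l[of k] by (intro cells_is_block idx) simp_all
  qed
  finally show ?thesis .
qed

lemma valid: "valid_solution E Q"
  unfolding valid_solution_def
proof (intro conjI ballI)
  show "Q \<subseteq> board E" by (auto simp: Q_def)
  show "squares E \<subseteq> Q"
    using clues inst by (auto simp: clue_constraints_def Q_def evolomino_instance_def)
  show "Q \<inter> shaded E = {}"
    using clues by (auto simp: clue_constraints_def Q_def)
next
  fix B assume "B \<in> blocks E Q"
  then obtain a k where ak: "(a, k) \<in> index" "cells (a, k) \<noteq> {}" "B = cells (a, k)"
    by (auto simp: blocks_eq)
  then have "int (card (cells (a, k) \<inter> set a)) = 1"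
    using card_arrow_cells[OF ak(1)] cells_active[OF ak(1)] by simp
  then show "card (B \<inter> arrow_cells E) = 1" using ak cells_arrow_cells by simp
next
  fix a assume a: "a \<in> arrows E"
  have two: "2 \<le> max_blocks a" "b a 1 = 1" "b a 2 = 1"
    using clues a by (auto simp: clue_constraints_def)
  have idx: "(a, 1) \<in> index" "(a, 2) \<in> index" using a two by (auto simp: index_def)
  have meets: "cells (a, k) \<in> {B \<in> blocks E Q. B \<inter> set a \<noteq> {}}" if "(a, k) \<in> index" "b a k = 1" for k
    using that card_arrow_cells[OF that(1)] cells_active[OF that(1)] by (auto simp: blocks_eq)
  have "cells (a, 1) \<noteq> cells (a, 2)"
    using cells_disjoint[OF idx] cells_active[OF idx(1)] two(2) by auto
  then have "2 = card {cells (a, 1), cells (a, 2)}" by simp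
  also have "\<dots> \<le> card {B \<in> blocks E Q. B \<inter> set a \<noteq> {}}"
  proof (rule card_mono)
    have "finite Q" using finite_board by (rule rev_finite_subset) (auto simp: Q_def)
    then show "finite {B \<in> blocks E Q. B \<inter> set a \<noteq> {}}" by (simp add: blocks_def)
    show "{cells (a, 1), cells (a, 2)} \<subseteq> {B \<in> blocks E Q. B \<inter> set a \<noteq> {}}"
      using meets[OF idx(1) two(2)] meets[OF idx(2) two(3)] by blast
  qed
  finally show "2 \<le> card {B \<in> blocks E Q. B \<inter> set a \<noteq> {}}" .
next
  fix a assume a: "a \<in> arrows E"
  obtain L where L: "2 \<le> L" "L \<le> max_blocks a"
    and active: "\<forall>k\<in>{1..max_blocks a}. b a k = 1 \<longleftrightarrow> k \<le> L"
    by (rule active_prefix[OF a])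
  show "successively (evolves E) (blocks_along E Q a)"
    unfolding blocks_along_eq[OF a L(2) active] successively_conv_nth
  proof (intro allI impI)
    fix i assume "Suc i < length (map (\<lambda>k. cells (a, k)) [1..<Suc L])"
    then have i: "Suc (Suc i) \<le> L" by (simp del: upt_Suc)
    then have "(a, Suc (Suc i)) \<in> index" "b a (Suc (Suc i)) = 1"
      using a L active by (auto simp: index_def)
    then have "evolves E (cells (a, Suc i)) (cells (a, Suc (Suc i)))"
      using cells_evolve[of a "Suc (Suc i)"] by simp
    then show "evolves E (map (\<lambda>k. cells (a, k)) [1..<Suc L] ! i)
        (map (\<lambda>k. cells (a, k)) [1..<Suc L] ! Suc i)"
      using i by (simp del: upt_Suc)
  qed
qed

end

section \<open>From a solution of the puzzle to a solution of the system\<close>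

locale puzzle_solution = cell_assignment +
  fixes M :: int
  assumes solved: "valid_solution E Q"
    and big: "exceeds_blocks E M"
begin

definition visited :: "nat list \<Rightarrow> nat list" where
  "visited a = filter (\<lambda>i. i \<in> Q) a"

text \<open>Block numbers start at 1 and list positions at 0. Beyond the last block the set is empty, so
that all variables derived from it vanish on inactive indices.\<close>

definition block :: "nat list \<Rightarrow> nat \<Rightarrow> nat set" where
  "block a k = (if k \<in> {1..length (visited a)} then block_of E Q (visited a ! (k - 1)) else {})"

lemma Q_board: "Q \<subseteq> board E"
  by (auto simp: Q_def)

lemma visited_nth:
  assumes "k \<in> {1..length (visited a)}"
  shows "visited a ! (k - 1) \<in> set a" "visited a ! (k - 1) \<in> Q"
proof -
  have "visited a ! (k - 1) \<in> set (visited a)" using assms by (intro nth_mem) auto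
  then show "visited a ! (k - 1) \<in> set a" "visited a ! (k - 1) \<in> Q"
    by (auto simp: visited_def)
qed

lemma block_subset_Q: "block a k \<subseteq> Q"
  using visited_nth(2) block_of_subset by (auto simp: block_def)

lemma finite_block: "finite (block a k)"
  using finite_subset[OF order_trans[OF block_subset_Q Q_board] finite_board] .

text \<open>The rule that a block has one cell on an arrow, in the form on which every later separation of
blocks rests.\<close>

lemma one_arrow_cell:
  assumes i: "i \<in> Q" and j: "j \<in> block_of E Q i" "j \<in> arrow_cells E"
    and j': "j' \<in> block_of E Q i" "j' \<in> arrow_cells E"
  shows "j = j'"
proof -
  have "card (block_of E Q i \<inter> arrow_cells E) = 1"
    using solved i by (auto simp: valid_solution_def blocks_def)
  then show ?thesis using j j' by (metis IntI card_1_singletonE singletonD)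
qed

lemma block_arrow_cells:
  assumes a: "a \<in> arrows E" and k: "k \<in> {1..length (visited a)}"
  shows "block a k \<inter> arrow_cells E = {visited a ! (k - 1)}"
proof -
  let ?r = "visited a ! (k - 1)"
  have r: "?r \<in> Q" "?r \<in> arrow_cells E" "?r \<in> block_of E Q ?r"
    using visited_nth[OF k] a block_of_refl by (auto simp: arrow_cells_def)
  then have "j = ?r" if "j \<in> block_of E Q ?r" "j \<in> arrow_cells E" for j
    using one_arrow_cell that by blast
  then show ?thesis using k r by (auto simp: block_def)
qed

lemma block_own_arrow:
  assumes a: "a \<in> arrows E" and k: "k \<in> {1..length (visited a)}"
  shows "block a k \<inter> set a = {visited a ! (k - 1)}"
  using block_arrow_cells[OF a k] visited_nth(1)[OF k] a by (auto simp: arrow_cells_def)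

text \<open>Overlapping blocks are equal as components, hence share their only arrow cell, and that cell
determines the arrow and the position along it.\<close>

lemma block_inj:
  assumes a: "a \<in> arrows E" "a' \<in> arrows E" and i: "i \<in> block a k" "i \<in> block a' k'"
  shows "a = a' \<and> k = k'"
proof -
  have k: "k \<in> {1..length (visited a)}" "k' \<in> {1..length (visited a')}"
    using i by (auto simp: block_def split: if_splits)
  have "block a k = block a' k'"
    using i k block_of_eq unfolding block_def by metis
  then have r: "visited a ! (k - 1) = visited a' ! (k' - 1)"
    using block_arrow_cells[OF a(1) k(1)] block_arrow_cells[OF a(2) k(2)] by simp
  then have eq: "a = a'"
    using arrows_disjoint[OF a visited_nth(1)[OF k(1)]] visited_nth(1)[OF k(2)] by simp
  have "distinct (visited a)" using arrow(1)[OF a(1)] by (simp add: visited_def)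
  moreover have "k - 1 < length (visited a)" "k' - 1 < length (visited a)" using k eq by auto
  ultimately have "k - 1 = k' - 1" using r eq by (simp add: nth_eq_iff_index_eq)
  then show ?thesis using eq k by auto
qed

lemma block_closed:
  assumes "i \<in> block a k" "j \<in> Q" "adjacent E i j"
  shows "j \<in> block a k"
proof -
  have "i \<in> Q" using assms(1) block_subset_Q by blast
  then show ?thesis
    using assms block_of_step by (auto simp: block_def split: if_splits)
qed

lemma blocks_separated:
  assumes a: "a \<in> arrows E" "a' \<in> arrows E" "a \<noteq> a' \<or> k \<noteq> k'"
    and i: "i \<in> block a k" and j: "j \<in> block a' k'"
  shows "\<not> adjacent E i j"
  using block_closed[OF i] block_inj[OF a(1,2)] a(3) j block_subset_Q by blast

lemma covered:
  assumes i: "i \<in> Q"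
  obtains a k where "a \<in> arrows E" "k \<in> {1..length (visited a)}" "i \<in> block a k"
proof -
  have "card (block_of E Q i \<inter> arrow_cells E) = 1"
    using solved i by (auto simp: valid_solution_def blocks_def)
  then obtain c where c: "c \<in> block_of E Q i" "c \<in> arrow_cells E"
    by (metis IntE card_1_singletonE insertI1)
  then obtain a where a: "a \<in> arrows E" "c \<in> set a" by (auto simp: arrow_cells_def)
  have "c \<in> set (visited a)" using a c block_of_subset[OF i] by (auto simp: visited_def)
  then obtain n where n: "n < length (visited a)" "visited a ! n = c" by (auto simp: in_set_conv_nth)
  have "block a (Suc n) = block_of E Q i" using n block_of_eq[OF c(1)] by (simp add: block_def)
  then show thesis using that[of a "Suc n"] a n block_of_refl by auto
qed

text \<open>A block is reached from its arrow cell without meeting an excluded cell. Shaded cells carry no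
square, and a cell of another arrow would be a second arrow cell of the block. So would a
pre-drawn square on another arrow, which belongs to every block that has a cell next to it.\<close>

lemma block_subset_reach:
  assumes a: "a \<in> arrows E"
  shows "block a k \<subseteq> reach E a"
proof (cases "k \<in> {1..length (visited a)}")
  case False then show ?thesis by (auto simp: block_def)
next
  case k: True
  let ?r = "visited a ! (k - 1)"
  have r: "?r \<in> Q" "?r \<in> set a" using visited_nth[OF k] by auto
  have free: "j \<notin> excluded E a" if j: "j \<in> block_of E Q ?r" "j \<notin> set a" for j
  proof
    have jQ: "j \<in> Q" using j block_of_subset[OF r(1)] by blast
    have off: "j \<notin> arrow_cells E"
    proof
      assume "j \<in> arrow_cells E"
      then have "j = ?r" using block_arrow_cells[OF a k] j(1) k by (auto simp: block_def)
      then show False using r(2) j(2) by simp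
    qed
    assume "j \<in> excluded E a"
    then consider "j \<in> shaded E" | a' where "a' \<in> arrows E" "j \<in> set a'"
      | a' s where "a' \<in> arrows E" "a' \<noteq> a" "s \<in> squares E" "s \<in> set a'" "adjacent E s j"
      unfolding excluded_def by blast
    then show False
    proof cases
      case 1 then show False using solved jQ by (auto simp: valid_solution_def)
    next
      case 2 then show False using off by (auto simp: arrow_cells_def)
    next
      case 3
      then have "s \<in> Q" using solved by (auto simp: valid_solution_def)
      then have "s \<in> block_of E Q ?r"
        using block_of_step[OF j(1) jQ] 3 adjacent_sym by blast
      then have "s = ?r"
        using block_arrow_cells[OF a k] 3 k by (auto simp: block_def arrow_cells_def)
      then show False using arrows_disjoint[OF a 3(1)] r(2) 3 by blast
    qed
  qed
  have "block_of E Q ?r \<subseteq> reach E a"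
  proof
    fix j assume "j \<in> block_of E Q ?r"
    then have "(\<lambda>u v. u \<in> Q \<and> v \<in> Q \<and> adjacent E u v)\<^sup>*\<^sup>* ?r j" by (simp add: block_of_def)
    then show "j \<in> reach E a"
    proof (induction rule: rtranclp_induct)
      case base then show ?case using r(2) arrow_subset_reach by blast
    next
      case (step u v)
      have "v \<in> block_of E Q ?r"
        using step(1,2) unfolding block_of_def by (auto intro: rtranclp.rtrancl_into_rtrancl)
      show ?case
      proof (cases "v \<in> set a")
        case True then show ?thesis using arrow_subset_reach by blast
      next
        case False
        then have "adjacent E u v \<and> v \<notin> excluded E a"
          using free \<open>v \<in> block_of E Q ?r\<close> step(2) by blast
        then show ?thesis using step.IH unfolding reach_def
          by (auto intro: rtranclp.rtrancl_into_rtrancl)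
      qed
    qed
  qed
  then show ?thesis using k by (simp add: block_def)
qed

text \<open>Two adjacent squares on an arrow would lie in one block and give it two arrow cells.\<close>

lemma not_consecutive:
  assumes a: "a \<in> arrows E"
  shows "successively (\<lambda>u v. \<not> (u \<in> Q \<and> v \<in> Q)) a"
proof (rule ccontr)
  assume "\<not> ?thesis"
  then obtain l where l: "Suc l < length a" "a ! l \<in> Q" "a ! Suc l \<in> Q"
    unfolding successively_conv_nth by blast
  have "adjacent E (a ! l) (a ! Suc l)" using arrow(4)[OF a] l(1) by (simp add: successively_conv_nth)
  then have "a ! Suc l \<in> block_of E Q (a ! l)" by (rule block_of_step[OF block_of_refl l(2,3)])
  moreover have "a ! l \<in> arrow_cells E" "a ! Suc l \<in> arrow_cells E"
    using a nth_mem[OF l(1)] nth_mem[OF Suc_lessD[OF l(1)]] unfolding arrow_cells_def by blast+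
  ultimately have "a ! l = a ! Suc l" using one_arrow_cell[OF l(2) block_of_refl] by blast
  then show False using arrow(1)[OF a] l(1) by (simp add: nth_eq_iff_index_eq)
qed

lemma length_visited_le:
  assumes a: "a \<in> arrows E" shows "length (visited a) \<le> max_blocks a"
  using length_filter_le_half[OF not_consecutive[OF a]] by (simp add: visited_def max_blocks_def)

lemma length_visited_ge:
  assumes a: "a \<in> arrows E" shows "2 \<le> length (visited a)"
proof -
  have "2 \<le> card {B \<in> blocks E Q. B \<inter> set a \<noteq> {}}" using solved a by (auto simp: valid_solution_def)
  also have "\<dots> \<le> card (block_of E Q ` set (visited a))"
  proof (intro card_mono subsetI)
    fix B assume "B \<in> {B \<in> blocks E Q. B \<inter> set a \<noteq> {}}"
    then obtain i j where ij: "i \<in> Q" "B = block_of E Q i" "j \<in> B" "j \<in> set a"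
      by (auto simp: blocks_def)
    then have "j \<in> set (visited a)" using block_of_subset[OF ij(1)] by (auto simp: visited_def)
    then show "B \<in> block_of E Q ` set (visited a)" using block_of_eq ij by blast
  qed simp
  also have "\<dots> \<le> card (set (visited a))" by (rule card_image_le) simp
  also have "\<dots> \<le> length (visited a)" by (rule card_length)
  finally show ?thesis .
qed

text \<open>The empty sets beyond the last block fit as well, since \<open>M\<close> exceeds the size of the first
block and is therefore positive.\<close>

lemma card_block_less:
  assumes a: "a \<in> arrows E" shows "int (card (block a k)) < M"
proof -
  have in_range: "int (card (block a k)) < M" if k: "k \<in> {1..length (visited a)}" for k
  proof -
    have "block a k \<in> blocks E Q" using k visited_nth[OF k] by (simp add: block_def blocks_def)
    then show ?thesis using big solved by (auto simp: exceeds_blocks_def)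
  qed
  moreover have "0 < M"
  proof -
    have "0 \<le> int (card (block a 1))" by simp
    also have "\<dots> < M" using length_visited_ge[OF a] by (intro in_range) auto
    finally show ?thesis .
  qed
  ultimately show ?thesis by (cases "k \<in> {1..length (visited a)}") (auto simp: block_def)
qed

text \<open>The arrow cell \<open>visited a ! (k - 1)\<close> receives as many units as the block has cells and every
cell, including that one, keeps one unit.\<close>

definition feeds :: "nat list \<Rightarrow> nat \<Rightarrow> (nat \<Rightarrow> nat \<Rightarrow> int) \<Rightarrow> bool" where
  "feeds a k f \<longleftrightarrow>
    (\<forall>i j. 0 \<le> f i j \<and> f i j \<le> int (card (block a k))) \<and>
    (\<forall>i j. f i j \<noteq> 0 \<longrightarrow> i \<in> block a k \<and> j \<in> block a k \<and> adjacent E i j) \<and>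
    (\<forall>i\<in>block a k. (\<Sum>j\<in>block a k. f j i) - (\<Sum>j\<in>block a k. f i j)
      = 1 - (if i = visited a ! (k - 1) then int (card (block a k)) else 0))"

lemma feeding_flow_exists: "\<exists>f. feeds a k f"
proof (cases "k \<in> {1..length (visited a)}")
  case False
  then have "block a k = {}" unfolding block_def by (rule if_not_P)
  then have "feeds a k (\<lambda>_ _. 0)" by (simp add: feeds_def)
  then show ?thesis by blast
next
  case k: True
  let ?r = "visited a ! (k - 1)"
  have B: "block a k = block_of E Q ?r" using k by (simp add: block_def)
  show ?thesis
    unfolding feeds_def
  proof (rule spanning_flow_exists[OF finite_block])
    show "?r \<in> block a k" using B block_of_refl by simp
    fix S assume S: "?r \<in> S" "S \<subset> block a k"
    show "\<exists>u\<in>S. \<exists>v\<in>block a k - S. adjacent E u v"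
    proof (rule ccontr)
      assume "\<not> ?thesis"
      then have "v \<in> S" if "u \<in> S" "v \<in> Q" "adjacent E u v" for u v
        using that S block_closed by blast
      then have "block a k \<subseteq> S" unfolding B by (intro block_of_least S(1))
      then show False using S(2) by blast
    qed
  qed
qed

text \<open>The index set of translations leaves out the shortest vectors. Nothing is lost: the zero vector
would make two consecutive blocks overlap and a unit vector would make them touch, but distinct
blocks do neither.\<close>

lemma block_translation:
  assumes a: "a \<in> arrows E" and k: "2 \<le> k" "k \<le> length (visited a)"
  shows "card (block a k) = Suc (card (block a (k - 1)))"
    and "\<exists>p q. \<forall>i\<in>block a (k - 1). (p, q) \<in> shifts_at E a i \<and> shift E i p q \<in> block a k"
proof -
  let ?B = "block a (k - 1)" and ?B' = "block a k"
  have rng: "k - 1 \<in> {1..length (visited a)}" "k \<in> {1..length (visited a)}" using k by auto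
  have "successively (evolves E) (map (block_of E Q) (visited a))"
    using solved a by (auto simp: valid_solution_def blocks_along_def visited_def)
  then have "evolves E (block_of E Q (visited a ! n)) (block_of E Q (visited a ! Suc n))"
    if "Suc n < length (visited a)" for n
    using that by (simp add: successively_conv_nth)
  moreover obtain n where n: "k = Suc (Suc n)" using k(1) by (metis Suc_le_D numeral_2_eq_2 Suc_le_mono)
  ultimately have "evolves E ?B ?B'"
    using k rng by (simp add: block_def)
  then obtain p q c where c: "c \<notin> (\<lambda>(r, s). (r + p, s + q)) ` coords E ?B"
    and eq: "coords E ?B' = insert c ((\<lambda>(r, s). (r + p, s + q)) ` coords E ?B)"
    unfolding evolves_def by blast
  have inj: "inj_on (\<lambda>i. (int (row_of E i), int (col_of E i))) (block a k)" for k
    by (rule inj_on_subset[OF inj_on_coordinates order_trans[OF block_subset_Q Q_board]])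
  have "finite (coords E ?B)" by (simp add: coords_def finite_block)
  then have "card (coords E ?B') = Suc (card ((\<lambda>(r, s). (r + p, s + q)) ` coords E ?B))"
    using c eq by simp
  also have "card ((\<lambda>(r, s). (r + p, s + q)) ` coords E ?B) = card (coords E ?B)"
    by (rule card_image) (auto simp: inj_on_def)
  finally show "card ?B' = Suc (card ?B)"
    using card_image[OF inj] by (simp add: coords_def)
  have moved: "shift E i p q \<in> ?B' \<and> int (row_of E (shift E i p q)) = int (row_of E i) + p
      \<and> int (col_of E (shift E i p q)) = int (col_of E i) + q" if i: "i \<in> ?B" for i
  proof -
    have "(int (row_of E i) + p, int (col_of E i) + q) \<in> coords E ?B'"
      using i eq by (force simp: coords_def)
    then obtain j where j: "j \<in> ?B'" "int (row_of E j) = int (row_of E i) + p"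
      "int (col_of E j) = int (col_of E i) + q" by (auto simp: coords_def)
    moreover have "i \<in> board E" "j \<in> board E" using i j block_subset_Q Q_board by blast+
    ultimately show ?thesis using shift_eq[of i E j p q] by simp
  qed
  have "(p, q) \<in> shifts_at E a i" if i: "i \<in> ?B" for i
  proof -
    let ?j = "shift E i p q"
    have j: "?j \<in> ?B'" "int (row_of E ?j) = int (row_of E i) + p"
      "int (col_of E ?j) = int (col_of E i) + q" using moved[OF i] by auto
    have board: "i \<in> board E" "?j \<in> board E" using i j(1) block_subset_Q Q_board by blast+
    have "\<not> adjacent E i ?j" using blocks_separated[OF a a _ i j(1)] k by auto
    then have "\<bar>p\<bar> + \<bar>q\<bar> \<noteq> 1" using board j(2,3) by (simp add: adjacent_def)
    moreover have "\<bar>p\<bar> + \<bar>q\<bar> \<noteq> 0"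
    proof
      assume "\<bar>p\<bar> + \<bar>q\<bar> = 0"
      then have "p = 0" "q = 0" by auto
      then have "row_of E ?j = row_of E i" "col_of E ?j = col_of E i" using j(2,3) by simp_all
      then have "?j = i" using cell_eqI board by blast
      then show False using block_inj[OF a a i, of k] j(1) k by auto
    qed
    moreover have "0 \<le> \<bar>p\<bar> + \<bar>q\<bar>" by simp
    ultimately have long: "\<bar>p\<bar> + \<bar>q\<bar> > 1" by linarith
    note bounds = coordinate_bounds[OF board(1)] coordinate_bounds[OF board(2)]
    have "\<bar>p\<bar> \<le> int (nrows E) - 1" "\<bar>q\<bar> \<le> int (ncols E) - 1"
      using bounds j(2,3) by linarith+
    with long have "(p, q) \<in> shifts E" by (simp add: shifts_def)
    moreover have "1 \<le> int (row_of E i) + p" "int (row_of E i) + p \<le> int (nrows E)"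
      "1 \<le> int (col_of E i) + q" "int (col_of E i) + q \<le> int (ncols E)"
      using bounds j(2,3) by linarith+
    moreover have "?j \<in> reach E a" using j(1) block_subset_reach[OF a] by blast
    ultimately show ?thesis by (simp add: shifts_at_def)
  qed
  then show "\<exists>p q. \<forall>i\<in>?B. (p, q) \<in> shifts_at E a i \<and> shift E i p q \<in> ?B'"
    using moved by blast
qed

definition y :: y_var where "y a k i = of_bool (i \<in> block a k)"

definition b :: block_var where "b a k = of_bool (k \<le> length (visited a))"

definition N :: block_var where "N a k = int (card (block a k))"

text \<open>A block meets its arrow in one cell only, so the whole supply enters there.\<close>

definition F :: y_var where "F a k i = N a k * y a k i"

definition f :: flow_var where "f a k = (SOME f. feeds a k f)"

text \<open>Two consecutive blocks can be related by several translations, as a single square and a domino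
show; any one of them will do.\<close>

definition translation :: "nat list \<Rightarrow> nat \<Rightarrow> int \<times> int" where
  "translation a k = (SOME pq. \<forall>i\<in>block a (k - 1).
    pq \<in> shifts_at E a i \<and> shift E i (fst pq) (snd pq) \<in> block a k)"

definition t :: t_var where
  "t a k pq = of_bool (k \<le> length (visited a) \<and> pq = translation a k)"

lemma y_sum:
  assumes "finite A" shows "(\<Sum>i\<in>A. y a k i) = int (card (block a k \<inter> A))"
  using assms by (simp add: y_def Int_commute)

lemma block_empty: "\<not> k \<le> length (visited a) \<Longrightarrow> block a k = {}"
  by (simp add: block_def)

lemma N_eq_0: "\<not> k \<le> length (visited a) \<Longrightarrow> N a k = 0"
  by (simp add: N_def block_empty)

lemma N_bounds:
  assumes "a \<in> arrows E" shows "0 \<le> N a k" "N a k < M"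
  using card_block_less[OF assms] by (auto simp: N_def)

lemma card_block_own_arrow:
  assumes "a \<in> arrows E" "1 \<le> k"
  shows "int (card (block a k \<inter> set a)) = b a k"
  using assms block_own_arrow[of a k] by (cases "k \<le> length (visited a)") (auto simp: b_def block_empty)

lemma binary: "binary_vars E y b t"
  by (simp add: binary_vars_def y_def b_def t_def)

lemma clue: "clue_constraints E x b"
proof -
  have "x i = 1" if "i \<in> squares E" for i
    using solved that by (auto simp: valid_solution_def Q_def)
  moreover have "x i = 0" if i: "i \<in> shaded E" for i
  proof -
    have "i \<in> board E" using inst i by (auto simp: evolomino_instance_def)
    moreover have "i \<notin> Q" using solved i by (auto simp: valid_solution_def)
    ultimately show ?thesis by (simp add: x_eq)
  qed
  moreover have "2 \<le> max_blocks a \<and> b a 1 = 1 \<and> b a 2 = 1" if "a \<in> arrows E" for a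
    using length_visited_le[OF that] length_visited_ge[OF that] by (auto simp: b_def)
  ultimately show ?thesis by (simp add: clue_constraints_def)
qed

text \<open>Every square lies in exactly one block, and that block has exactly one number on one arrow.\<close>

lemma x_is_sum:
  assumes i: "i \<in> board E"
  shows "(\<Sum>a\<in>{a \<in> arrows E. i \<in> reach E a}. \<Sum>k=1..max_blocks a. y a k i) = x i"
proof -
  let ?C = "\<lambda>ak. block (fst ak) (snd ak)"
  have "(\<Sum>a\<in>{a \<in> arrows E. i \<in> reach E a}. \<Sum>k=1..max_blocks a. y a k i)
      = int (card {ak \<in> index. i \<in> ?C ak})"
    using block_subset_reach by (intro sum_over_index) (auto simp: index_def y_def)
  also have "\<dots> = x i"
  proof (cases "i \<in> Q")
    case True
    then obtain a k where a: "a \<in> arrows E" "k \<in> {1..length (visited a)}" "i \<in> block a k"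
      by (rule covered)
    have "{ak \<in> index. i \<in> ?C ak} = {(a, k)}"
    proof (intro equalityI subsetI)
      fix ak assume "ak \<in> {ak \<in> index. i \<in> ?C ak}"
      then show "ak \<in> {(a, k)}"
        using block_inj[of "fst ak" a i "snd ak" k] a by (cases ak) (auto simp: index_def)
    next
      fix ak assume "ak \<in> {(a, k)}"
      then show "ak \<in> {ak \<in> index. i \<in> ?C ak}"
        using a length_visited_le[OF a(1)] by (auto simp: index_def)
    qed
    then show ?thesis using True i by (simp add: x_eq)
  next
    case False
    then have "{ak \<in> index. i \<in> ?C ak} = {}" using block_subset_Q by blast
    then have "card {ak \<in> index. i \<in> ?C ak} = 0" by (simp only: card.empty)
    then show ?thesis using False i by (simp add: x_eq)
  qed
  finally show ?thesis .
qed

text \<open>Blocks are numbered in the order in which the arrow meets them, so block \<open>k\<close> has no cell on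
the arrow before the cell of block \<open>k - 1\<close>. At any other cell \<open>i\<close> the inequality only says that
the block meets the arrow at most once.\<close>

lemma blocks_in_order:
  assumes a: "a \<in> arrows E" and k: "2 \<le> k"
  shows "(\<Sum>j\<in>preceding a i. y a k j) \<le> 1 - y a (k - 1) i"
proof -
  have sub: "preceding a i \<subseteq> set a" by (auto simp: preceding_def)
  then have fin: "finite (preceding a i)" by (rule finite_subset) simp
  show ?thesis
  proof (cases "i \<in> block a (k - 1)")
    case False
    have "card (block a k \<inter> preceding a i) \<le> card (block a k \<inter> set a)"
      using sub by (intro card_mono) auto
    also have "int \<dots> \<le> 1" using card_block_own_arrow[OF a, of k] k by (simp add: b_def)
    finally show ?thesis using y_sum[OF fin] False by (simp add: y_def)
  next
    case True
    have "j \<notin> preceding a i" if j: "j \<in> block a k" for j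
    proof
      assume "j \<in> preceding a i"
      then obtain l l' where l: "j = a ! l" "l < l'" "l' < length a" "a ! l' = i"
        by (auto simp: preceding_def)
      have rng: "k - 1 \<in> {1..length (visited a)}" "k \<in> {1..length (visited a)}"
        using True j by (auto simp: block_def split: if_splits)
      have "i \<in> set a" "j \<in> set a" using l by auto
      then have "i = visited a ! (k - 1 - 1)" "j = visited a ! (k - 1)"
        using block_own_arrow[OF a rng(1)] block_own_arrow[OF a rng(2)] True j by blast+
      then have "a ! l' = visited a ! (k - 1 - 1)" "a ! l = visited a ! (k - 1)"
        using l by simp_all
      moreover have "k - 1 - 1 < k - 1" "k - 1 < length (visited a)" using rng by auto
      ultimately have "l' < l"
        using l(2,3) filter_keeps_order[OF arrow(1)[OF a], of "k - 1 - 1" "k - 1" "\<lambda>i. i \<in> Q" l' l]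
        by (simp add: visited_def)
      then show False using l(2) by simp
    qed
    then have "block a k \<inter> preceding a i = {}" by blast
    then show ?thesis using y_sum[OF fin] True by (simp add: y_def)
  qed
qed

lemma basic: "basic_constraints E M x y b N"
  unfolding basic_constraints_def
proof (intro conjI ballI allI impI)
  fix a l assume a: "a \<in> arrows E" and l: "Suc l < length a"
  have "a ! l \<in> board E" "a ! Suc l \<in> board E"
    using arrow(2)[OF a] nth_mem[OF l] nth_mem[OF Suc_lessD[OF l]] by blast+
  moreover have "\<not> (a ! l \<in> Q \<and> a ! Suc l \<in> Q)"
    using not_consecutive[OF a] l unfolding successively_conv_nth by blast
  ultimately show "x (a ! l) + x (a ! Suc l) \<le> 1" by (auto simp: x_eq)
next
  fix a k assume a: "a \<in> arrows E" and k: "k \<in> {1..max_blocks a}"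
  have "(\<Sum>i\<in>reach E a. y a k i) = N a k"
    using y_sum[OF finite_reach[OF a]] block_subset_reach[OF a] by (simp add: N_def Int_absorb2)
  then show "(\<Sum>i\<in>reach E a. y a k i) \<le> M * b a k" and "N a k = (\<Sum>i\<in>reach E a. y a k i)"
    using N_bounds[OF a, of k] N_eq_0[of k a] by (auto simp: b_def)
  show "(\<Sum>i\<in>set a. y a k i) = b a k"
    using y_sum[of "set a"] card_block_own_arrow[OF a, of k] k by simp
next
  fix a k assume a: "a \<in> arrows E" and k: "k \<in> {2..max_blocks a}"
  show "b a k \<le> b a (k - 1)" by (auto simp: b_def)
  show "(\<Sum>j\<in>preceding a i. y a k j) \<le> 1 - y a (k - 1) i" for i
    using blocks_in_order[OF a] k by simp
  show "N a k \<ge> N a (k - 1) + 1 - M * (1 - b a k)" "N a k \<le> N a (k - 1) + 1 + M * (1 - b a k)"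
  proof -
    have "N a k = N a (k - 1) + 1" if "k \<le> length (visited a)"
      using block_translation(1)[OF a _ that] k by (simp add: N_def)
    then show "N a k \<ge> N a (k - 1) + 1 - M * (1 - b a k)" "N a k \<le> N a (k - 1) + 1 + M * (1 - b a k)"
      using N_bounds[OF a, of "k - 1"] N_eq_0[of k a] by (cases "k \<le> length (visited a)"; simp add: b_def)+
  qed
next
  fix a a' :: "nat list" and k k' i :: nat
  assume a: "a \<in> arrows E" "a' \<in> arrows E" and ne: "a \<noteq> a' \<or> k \<noteq> k'"
    and i: "i \<in> reach E a"
  have board: "i \<in> board E" using i reach_subset_board[OF a(1)] by blast
  have sep: "y a k i + y a' k' j \<le> 1" if "adjacent E i j" for j
    using blocks_separated[OF a ne] that by (auto simp: y_def)
  show "y a k i + y a' k' (i + 1) \<le> 1" if "col_of E i < ncols E \<and> i + 1 \<in> reach E a'"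
    using sep adjacent_right[OF board] that by blast
  show "y a k i + y a' k' (i + ncols E) \<le> 1" if "row_of E i < nrows E \<and> i + ncols E \<in> reach E a'"
    using sep adjacent_below[OF board] that by blast
qed (rule x_is_sum)

lemma connectivity: "connectivity_constraints E M y N f F"
  unfolding connectivity_constraints_def
proof (intro ballI)
  fix a k assume a: "a \<in> arrows E" and k: "k \<in> {1..max_blocks a}"
  let ?B = "block a k"
  have "feeds a k (f a k)" unfolding f_def by (rule someI_ex[OF feeding_flow_exists])
  then have bound: "0 \<le> f a k i j" "f a k i j \<le> N a k"
    and support: "f a k i j \<noteq> 0 \<Longrightarrow> i \<in> ?B \<and> j \<in> ?B \<and> adjacent E i j"
    and balance: "i \<in> ?B \<Longrightarrow> (\<Sum>j\<in>?B. f a k j i) - (\<Sum>j\<in>?B. f a k i j)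
      = 1 - (if i = visited a ! (k - 1) then N a k else 0)" for i j
    unfolding feeds_def N_def by blast+
  have own: "i = visited a ! (k - 1)" if "i \<in> ?B" "i \<in> set a" for i
    using block_own_arrow[OF a, of k] that by (auto simp: block_def split: if_splits)
  have own': "visited a ! (k - 1) \<in> set a" if "i \<in> ?B" for i
    using visited_nth(1)[of k a] that by (auto simp: block_def split: if_splits)
  have y01: "y a k i = of_bool (i \<in> ?B)" for i by (simp add: y_def)
  \<comment> \<open>The sums of the system run over neighbours, with or without those on the arrow. Every set J
     of cells that contains all with which i can exchange flow gives the same net inflow, and cells
     on the arrow exchange no flow with each other because a block has only one of them.\<close>
  have net: "(\<Sum>j\<in>J. f a k j i) - (\<Sum>j\<in>J. f a k i j) = y a k i - of_bool (i \<in> set a) * F a k i"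
    if J: "finite J" "\<And>j. j \<in> ?B \<Longrightarrow> adjacent E i j \<Longrightarrow> i \<notin> set a \<or> j \<notin> set a \<Longrightarrow> j \<in> J" for i J
  proof (cases "i \<in> ?B")
    case False
    then have "f a k j i = 0" "f a k i j = 0" for j using support by blast+
    then show ?thesis using False by (simp add: y01 F_def)
  next
    case True
    have out: "f a k j i = 0 \<and> f a k i j = 0" if "j \<in> ?B - J \<or> j \<in> J - ?B" for j
    proof (rule ccontr)
      assume "\<not> ?thesis"
      then have j: "j \<in> ?B" "adjacent E i j" using support adjacent_sym by blast+
      moreover have "i \<noteq> j" using j(2) by (auto simp: adjacent_def)
      ultimately show False using J(2)[of j] that own[OF True] own[of j] by blast
    qed
    have "(\<Sum>j\<in>J. f a k j i) = (\<Sum>j\<in>?B. f a k j i)" "(\<Sum>j\<in>J. f a k i j) = (\<Sum>j\<in>?B. f a k i j)"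
      using out J(1) finite_block by (auto intro: sum.mono_neutral_cong)
    then have "(\<Sum>j\<in>J. f a k j i) - (\<Sum>j\<in>J. f a k i j)
        = 1 - (if i = visited a ! (k - 1) then N a k else 0)"
      using balance[OF True] by simp
    moreover have "i \<in> set a \<longleftrightarrow> i = visited a ! (k - 1)"
      using own[OF True] own'[OF True] by blast
    ultimately show ?thesis using True by (simp add: y01 F_def)
  qed
  have fin: "finite (nbrs E a i)" for i
    using finite_reach[OF a] by (simp add: nbrs_def)
  have near: "j \<in> nbrs E a i" if "j \<in> ?B" "adjacent E i j" for i j
    using that block_subset_reach[OF a] by (auto simp: nbrs_def)
  have bounded: "0 \<le> F a k i \<and> F a k i \<le> M * y a k i"
    "f a k i j \<le> M * y a k i \<and> f a k i j \<le> M * y a k j \<and> f a k i j \<ge> 0" for i j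
  proof -
    show "0 \<le> F a k i \<and> F a k i \<le> M * y a k i"
      using N_bounds[OF a, of k] by (simp add: F_def y01)
    show "f a k i j \<le> M * y a k i \<and> f a k i j \<le> M * y a k j \<and> f a k i j \<ge> 0"
    proof (cases "f a k i j = 0")
      case True
      then show ?thesis using N_bounds[OF a, of k] by (simp add: y01)
    next
      case False
      then show ?thesis using support[OF False] bound[of i j] N_bounds[OF a, of k] by (simp add: y01)
    qed
  qed
  have total: "(\<Sum>i\<in>set a. F a k i) = N a k"
  proof -
    have "(\<Sum>i\<in>set a. F a k i) = N a k * b a k"
      using y_sum[of "set a" a k] card_block_own_arrow[OF a, of k] k by (simp add: F_def flip: sum_distrib_left)
    then show ?thesis using N_eq_0[of k a] by (auto simp: b_def)
  qed
  have inner: "(\<Sum>j\<in>nbrs E a i. f a k j i) - (\<Sum>j\<in>nbrs E a i. f a k i j) = y a k i"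
    if "i \<in> reach E a - set a" for i
    using net[OF fin near] that by simp
  have "(\<Sum>j\<in>nbrs E a i - set a. f a k j i) - (\<Sum>j\<in>nbrs E a i - set a. f a k i j) = y a k i - F a k i"
    if "i \<in> set a" for i
    using net[of "nbrs E a i - set a" i] fin near that by simp
  with bounded total inner show
    "(\<Sum>i\<in>set a. F a k i) = N a k \<and>
     (\<forall>i\<in>set a. 0 \<le> F a k i \<and> F a k i \<le> M * y a k i) \<and>
     (\<forall>i\<in>reach E a. \<forall>j\<in>nbrs E a i.
        f a k i j \<le> M * y a k i \<and> f a k i j \<le> M * y a k j \<and> f a k i j \<ge> 0) \<and>
     (\<forall>i\<in>reach E a - set a.
        (\<Sum>j\<in>nbrs E a i. f a k j i) - (\<Sum>j\<in>nbrs E a i. f a k i j) = y a k i) \<and>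
     (\<forall>i\<in>set a.
        (\<Sum>j\<in>nbrs E a i - set a. f a k j i) - (\<Sum>j\<in>nbrs E a i - set a. f a k i j)
          = y a k i - F a k i)"
    by blast
qed

text \<open>A translation admissible at every cell of a block is in particular admissible at its arrow
cell, which puts it into the index set of the variables \<open>t\<close>.\<close>

lemma translation_moves:
  assumes a: "a \<in> arrows E" and k: "2 \<le> k" "k \<le> length (visited a)" and i: "i \<in> block a (k - 1)"
  shows "translation a k \<in> shifts_at E a i \<inter> shifts_of E a"
    "shift E i (fst (translation a k)) (snd (translation a k)) \<in> block a k"
proof -
  have "\<exists>pq. \<forall>i\<in>block a (k - 1). pq \<in> shifts_at E a i \<and> shift E i (fst pq) (snd pq) \<in> block a k"
    using block_translation(2)[OF a k] by (metis fst_conv snd_conv)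
  then have all: "\<forall>i\<in>block a (k - 1). translation a k \<in> shifts_at E a i \<and>
      shift E i (fst (translation a k)) (snd (translation a k)) \<in> block a k"
    unfolding translation_def by (rule someI_ex)
  have "k - 1 \<in> {1..length (visited a)}" using k by auto
  from block_own_arrow[OF a this] obtain r where "r \<in> block a (k - 1)" "r \<in> set a" by blast
  then have "translation a k \<in> shifts_of E a" using all by (auto simp: shifts_of_def)
  then show "translation a k \<in> shifts_at E a i \<inter> shifts_of E a"
    "shift E i (fst (translation a k)) (snd (translation a k)) \<in> block a k"
    using all i by auto
qed

lemma evolution: "evolution_constraints E y b t"
  unfolding evolution_constraints_def
proof (intro ballI conjI)
  fix a k assume a: "a \<in> arrows E" and k: "k \<in> {2..max_blocks a}"
  then have k2: "2 \<le> k" by simp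
  have "k - 1 \<in> {1..length (visited a)}" if "k \<le> length (visited a)" using that k2 by auto
  then have tr: "translation a k \<in> shifts_of E a" if "k \<le> length (visited a)"
    using block_own_arrow[OF a] translation_moves(1)[OF a k2 that] that by blast
  show "(\<Sum>pq\<in>shifts_of E a. t a k pq) = b a k"
  proof (cases "k \<le> length (visited a)")
    case True
    then show ?thesis
      using tr finite_shifts_of by (simp add: t_def b_def of_bool_def)
  next
    case False then show ?thesis by (simp add: t_def b_def)
  qed
  fix i assume i: "i \<in> reach E a"
  show "(\<Sum>pq\<in>shifts_at E a i \<inter> shifts_of E a. t a k pq) \<ge> y a (k - 1) i + b a k - 1"
  proof (cases "i \<in> block a (k - 1) \<and> k \<le> length (visited a)")
    case True
    have "t a k (translation a k) \<le> (\<Sum>pq\<in>shifts_at E a i \<inter> shifts_of E a. t a k pq)"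
      using translation_moves(1)[OF a k2] True finite_shifts_of
      by (intro member_le_sum) (auto simp: t_def)
    then show ?thesis using True by (simp add: t_def y_def b_def)
  next
    case False
    have "0 \<le> (\<Sum>pq\<in>shifts_at E a i \<inter> shifts_of E a. t a k pq)"
      by (intro sum_nonneg) (simp add: t_def)
    then show ?thesis using False by (auto simp: y_def b_def)
  qed
  fix pq assume "pq \<in> shifts_at E a i \<inter> shifts_of E a"
  show "case pq of (p, q) \<Rightarrow> y a k (shift E i p q) \<ge> y a (k - 1) i - (1 - t a k (p, q))"
  proof (cases pq)
    case (Pair p q)
    show ?thesis
    proof (cases "i \<in> block a (k - 1) \<and> k \<le> length (visited a) \<and> pq = translation a k")
      case True
      then have "shift E i p q \<in> block a k"
        using translation_moves(2)[OF a k2, of i] Pair by (metis fst_conv snd_conv)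
      then show ?thesis using True unfolding Pair prod.case by (simp add: t_def y_def)
    next
      case False
      then show ?thesis unfolding Pair prod.case by (auto simp: t_def y_def)
    qed
  qed
qed

lemma satisfied: "satisfies_system E M x y b t N f F"
  using clue basic connectivity evolution by (simp add: satisfies_system_def)

end

section \<open>The equivalence\<close>

theorem theorem1:
  fixes E :: evolomino and M :: int and x :: "nat \<Rightarrow> int"
  assumes "evolomino_instance E"
    and "exceeds_blocks E M"
    and "\<forall>i\<in>board E. x i \<in> {0, 1}"
  shows "valid_solution E {i \<in> board E. x i = 1} \<longleftrightarrow>
    (\<exists>y b t N f F. binary_vars E y b t \<and> satisfies_system E M x y b t N f F)"
proof -
  interpret cell_assignment E x
    using assms by unfold_locales auto
  show ?thesis unfolding Q_def[symmetric]
  proof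
    assume "valid_solution E Q"
    then interpret puzzle_solution E x M
      using assms(2) by unfold_locales
    show "\<exists>y b t N f F. binary_vars E y b t \<and> satisfies_system E M x y b t N f F"
      using binary satisfied by blast
  next
    assume "\<exists>y b t N f F. binary_vars E y b t \<and> satisfies_system E M x y b t N f F"
    then obtain y b t N f F where "binary_vars E y b t" "satisfies_system E M x y b t N f F"
      by blast
    then interpret system_solution E x M y b t N f F
      by unfold_locales
    show "valid_solution E Q" by (rule valid)
  qed
qed

end
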